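(* Let $\mathcal A$ be an additive category and let $[f]\colon A\to B$ be a morphism in $\operatorname{Adel}(\mathcal A)$, represented by $f=(f_0,f_1,f_2)$. The morphism $$\mathrm I_f:=\left[\begin{pmatrix}f_0&\begin{pmatrix}0&a_0\end{pmatrix}\\ \begin{pmatrix}0\\ 1\end{pmatrix}&\begin{pmatrix}0&1\\ 0&0\end{pmatrix}\end{pmatrix},\begin{pmatrix}f_1&\begin{pmatrix}0&1\end{pmatrix}\\ \begin{pmatrix}0\\ 1\end{pmatrix}&0\end{pmatrix},\begin{pmatrix}f_2&\begin{pmatrix}0&1\end{pmatrix}\\ \begin{pmatrix}0\\ b_1\end{pmatrix}&\begin{pmatrix}0&0\\ 1&0\end{pmatrix}\end{pmatrix}\right]\colon \mathrm C(\mathrm k(f))\to \mathrm K(\mathrm c(f))$$ is an isomorphism in $\operatorname{Adel}(\mathcal A)$ with inverse $$\mathrm J_f:=\left[\begin{pmatrix}0&\begin{pmatrix}0&1\end{pmatrix}\\ 0&\begin{pmatrix}0&-1\\ 1&0\end{pmatrix}\end{pmatrix},\begin{pmatrix}0&\begin{pmatrix}0&1\end{pmatrix}\\ \begin{pmatrix}0\\ 1\end{pmatrix}&\begin{pmatrix}0&-b_0\\ -a_1&-f_1\end{pmatrix}\end{pmatrix},\begin{pmatrix}0&0\\ \begin{pmatrix}0\\ 1\end{pmatrix}&\begin{pmatrix}0&1\\ -1&0\end{pmatrix}\end{pmatrix}\right]\colon \mathrm K(\mathrm c(f))\to \mathrm C(\mathrm k(f)).$$ Moreover, $[\mathrm c(\mathrm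 k(f))]\,\mathrm I_f\,[\mathrm k(\mathrm c(f))]=[f]$, so $\mathrm I_f$ is the induced morphism of the kernel-cokernel-factorisation of $[f]$ formed with the kernel $[\mathrm k(f)]$ of $[f]$, the cokernel $[\mathrm c(f)]$ of $[f]$, the cokernel $[\mathrm c(\mathrm k(f))]$ of $[\mathrm k(f)]$ and the kernel $[\mathrm k(\mathrm c(f))]$ of $[\mathrm c(f)]$.
   Context: Conventions: morphisms are composed from left to right ($fg$ means first $f$, then $g$). A morphism $\bigoplus_k A_k\to\bigoplus_\ell B_\ell$ is written as a matrix $(f_{k\ell})$ with $f_{k\ell}\colon A_k\to B_\ell$ (rows indexed by the source), so that composition $fg$ is the matrix product in the written order. Adelman category: for an additive category $\mathcal A$, let $\mathcal A^{\Delta_2}$ be the category whose objects are diagrams $A=(A_0\xrightarrow{a_0}A_1\xrightarrow{a_1}A_2)$ in $\mathcal A$ (with no condition on $a_0a_1$) and whose morphisms $f\colon A\to B$ are triples $f=(f_0,f_1,f_2)$, $f_i\colon A_i\to B_i$, with $a_0f_1=f_0b_0$ and $a_1f_2=f_1b_1$. Such an $f$ is null-homotopic if there are morphisms $s\colon A_1\to B_0$ and $t\colon A_2\to B_1$ in $\mathcal A$ with $sb_0+a_1t=f_1$. The null-homotopic morphisms form an ideal of $\mathcal A^{\Delta_2}$, and $\operatorname{Adel}(\mathcal A)$ is the quotient category (same objects; morphisms are residue classes $[f]=[f_0,f_1,f_2]$). For $f\colon A\to B$ in $\mathcal A^{\Delta_2}$ set $$\mathrm K(f):=\Bigl(A_0\oplus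 B_0\xrightarrow{\left(\begin{smallmatrix}a_0&0\\ 0&1\end{smallmatrix}\right)}A_1\oplus B_0\xrightarrow{\left(\begin{smallmatrix}a_1&f_1\\ 0&-b_0\end{smallmatrix}\right)}A_2\oplus B_1\Bigr),\quad \mathrm k(f):=\Bigl(\left(\begin{smallmatrix}1\\ 0\end{smallmatrix}\right),\left(\begin{smallmatrix}1\\ 0\end{smallmatrix}\right),\left(\begin{smallmatrix}1\\ 0\end{smallmatrix}\right)\Bigr)\colon \mathrm K(f)\to A,$$ $$\mathrm C(f):=\Bigl(B_0\oplus A_1\xrightarrow{\left(\begin{smallmatrix}b_0&0\\ f_1&-a_1\end{smallmatrix}\right)}B_1\oplus A_2\xrightarrow{\left(\begin{smallmatrix}b_1&0\\ 0&1\end{smallmatrix}\right)}B_2\oplus A_2\Bigr),\quad \mathrm c(f):=\bigl((1\ 0),(1\ 0),(1\ 0)\bigr)\colon B\to \mathrm C(f).$$ Then $[\mathrm k(f)]$ is a kernel of $[f]$ and $[\mathrm c(f)]$ is a cokernel of $[f]$ in $\operatorname{Adel}(\mathcal A)$. Explicitly, $$\mathrm C(\mathrm k(f))=\Bigl(A_0\oplus(A_1\oplus B_0)\to A_1\oplus(A_2\oplus B_1)\to A_2\oplus(A_2\oplus B_1)\Bigr)$$ with maps $\begin{pmatrix}a_0&0\\ \left(\begin{smallmatrix}1\\ 0\end{smallmatrix}\right)&-\left(\begin{smallmatrix}a_1&f_1\\ 0&-b_0\end{smallmatrix}\right)\end{pmatrix}$ and $\begin{pmatrix}a_1&0\\ 0&1\end{pmatrix}$,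 and $$\mathrm K(\mathrm c(f))=\Bigl(B_0\oplus(B_0\oplus A_1)\to B_1\oplus(B_0\oplus A_1)\to B_2\oplus(B_1\oplus A_2)\Bigr)$$ with maps $\begin{pmatrix}b_0&0\\ 0&1\end{pmatrix}$ and $\begin{pmatrix}b_1&(1\ 0)\\ 0&-\left(\begin{smallmatrix}b_0&0\\ f_1&-a_1\end{smallmatrix}\right)\end{pmatrix}$. Kernel-cokernel-factorisation: given a morphism $g\colon X\to Y$ in a preadditive category with kernel $k$, cokernel $c$, a cokernel $p\colon X\to J$ of $k$ and a kernel $i\colon I\to Y$ of $c$, there is a unique $\hat g\colon J\to I$ with $p\hat gi=g$; these data form a kernel-cokernel-factorisation of $g$, and $\hat g$ is its induced morphism. *)

theory Defs
  imports "HOL-Algebra.Group"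
begin

section \<open>Categories\<close>

text \<open>
  Composition is written from left to right: \<open>f \<cdot> g\<close> means first \<open>f\<close>, then \<open>g\<close>.
  Only the values of \<open>Comp\<close> on composable arrows, of \<open>Add\<close> on parallel arrows, and so on, are
  meaningful.
\<close>

record ('o, 'm) category =
  Ob :: "'o set"
  Arr :: "'m set"
  Dom :: "'m \<Rightarrow> 'o"
  Cod :: "'m \<Rightarrow> 'o"
  Comp :: "'m \<Rightarrow> 'm \<Rightarrow> 'm"  (infixl \<open>\<cdot>\<index>\<close> 70)
  Idn :: "'o \<Rightarrow> 'm"

definition Hom :: "('o, 'm, 'z) category_scheme \<Rightarrow> 'o \<Rightarrow> 'o \<Rightarrow> 'm set" where
  "Hom C A B = {f \<in> Arr C. Dom C f = A \<and> Cod C f = B}"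

locale category = fixes C (structure)
  assumes Dom_in_Ob: "f \<in> Arr C \<Longrightarrow> Dom C f \<in> Ob C"
    and Cod_in_Ob: "f \<in> Arr C \<Longrightarrow> Cod C f \<in> Ob C"
    and Comp_in_Hom: "f \<in> Hom C X Y \<Longrightarrow> g \<in> Hom C Y Z \<Longrightarrow> f \<cdot> g \<in> Hom C X Z"
    and Idn_in_Hom: "X \<in> Ob C \<Longrightarrow> Idn C X \<in> Hom C X X"
    and Comp_assoc: "f \<in> Hom C W X \<Longrightarrow> g \<in> Hom C X Y \<Longrightarrow> h \<in> Hom C Y Z \<Longrightarrow>
      (f \<cdot> g) \<cdot> h = f \<cdot> (g \<cdot> h)"
    and Idn_Comp: "f \<in> Hom C X Y \<Longrightarrow> Idn C X \<cdot> f = f"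
    and Comp_Idn: "f \<in> Hom C X Y \<Longrightarrow> f \<cdot> Idn C Y = f"

definition is_inverse :: "('o, 'm, 'z) category_scheme \<Rightarrow> 'm \<Rightarrow> 'm \<Rightarrow> bool" where
  "is_inverse C f g \<longleftrightarrow> f \<in> Arr C \<and> g \<in> Hom C (Cod C f) (Dom C f) \<and>
     f \<cdot>\<^bsub>C\<^esub> g = Idn C (Dom C f) \<and> g \<cdot>\<^bsub>C\<^esub> f = Idn C (Cod C f)"

definition is_isomorphism :: "('o, 'm, 'z) category_scheme \<Rightarrow> 'm \<Rightarrow> bool" where
  "is_isomorphism C f \<longleftrightarrow> (\<exists>g. is_inverse C f g)"


section \<open>Preadditive and additive categories\<close>

record ('o, 'm) preadditive_category = "('o, 'm) category" +
  Add :: "'m \<Rightarrow> 'm \<Rightarrow> 'm"  (infixl \<open>\<^bold>+\<index>\<close> 65)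
  Zero :: "'o \<Rightarrow> 'o \<Rightarrow> 'm"

definition hom_group :: "('o, 'm, 'z) preadditive_category_scheme \<Rightarrow> 'o \<Rightarrow> 'o \<Rightarrow> 'm monoid" where
  "hom_group C A B = \<lparr>carrier = Hom C A B, monoid.mult = Add C, one = Zero C A B\<rparr>"

definition neg :: "('o, 'm, 'z) preadditive_category_scheme \<Rightarrow> 'm \<Rightarrow> 'm" where
  "neg C f = inv\<^bsub>hom_group C (Dom C f) (Cod C f)\<^esub> f"

locale preadditive_category = category C
  for C :: "('o, 'm, 'z) preadditive_category_scheme" (structure) +
  assumes hom_group_comm_group:
      "X \<in> Ob C \<Longrightarrow> Y \<in> Ob C \<Longrightarrow> comm_group (hom_group C X Y)"
    and Comp_Add: "f \<in> Hom C X Y \<Longrightarrow> g \<in> Hom C Y Z \<Longrightarrow> h \<in> Hom C Y Z \<Longrightarrow>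
      f \<cdot> (g \<^bold>+ h) = f \<cdot> g \<^bold>+ f \<cdot> h"
    and Add_Comp: "f \<in> Hom C X Y \<Longrightarrow> g \<in> Hom C X Y \<Longrightarrow> h \<in> Hom C Y Z \<Longrightarrow>
      (f \<^bold>+ g) \<cdot> h = f \<cdot> h \<^bold>+ g \<cdot> h"

definition is_zero_object :: "('o, 'm, 'z) category_scheme \<Rightarrow> 'o \<Rightarrow> bool" where
  "is_zero_object C Z \<longleftrightarrow> Z \<in> Ob C \<and>
     (\<forall>X\<in>Ob C. (\<exists>!f. f \<in> Hom C X Z) \<and> (\<exists>!f. f \<in> Hom C Z X))"

text \<open>
  An additive category carries an arbitrary choice of binary direct sums, with respect to which
  matrices of morphisms are formed.
\<close>

record ('o, 'm) additive_category = "('o, 'm) preadditive_category" +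
  DSum :: "'o \<Rightarrow> 'o \<Rightarrow> 'o"  (infixl \<open>\<oplus>\<index>\<close> 65)
  Inj1 :: "'o \<Rightarrow> 'o \<Rightarrow> 'm"
  Inj2 :: "'o \<Rightarrow> 'o \<Rightarrow> 'm"
  Prj1 :: "'o \<Rightarrow> 'o \<Rightarrow> 'm"
  Prj2 :: "'o \<Rightarrow> 'o \<Rightarrow> 'm"

locale additive_category = preadditive_category C
  for C :: "('o, 'm, 'z) additive_category_scheme" (structure) +
  assumes zero_object: "\<exists>Z. is_zero_object C Z"
    and DSum_in_Ob: "X \<in> Ob C \<Longrightarrow> Y \<in> Ob C \<Longrightarrow> X \<oplus> Y \<in> Ob C"
    and Inj1_in_Hom: "X \<in> Ob C \<Longrightarrow> Y \<in> Ob C \<Longrightarrow> Inj1 C X Y \<in> Hom C X (X \<oplus> Y)"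
    and Inj2_in_Hom: "X \<in> Ob C \<Longrightarrow> Y \<in> Ob C \<Longrightarrow> Inj2 C X Y \<in> Hom C Y (X \<oplus> Y)"
    and Prj1_in_Hom: "X \<in> Ob C \<Longrightarrow> Y \<in> Ob C \<Longrightarrow> Prj1 C X Y \<in> Hom C (X \<oplus> Y) X"
    and Prj2_in_Hom: "X \<in> Ob C \<Longrightarrow> Y \<in> Ob C \<Longrightarrow> Prj2 C X Y \<in> Hom C (X \<oplus> Y) Y"
    and Inj1_Prj1: "X \<in> Ob C \<Longrightarrow> Y \<in> Ob C \<Longrightarrow> Inj1 C X Y \<cdot> Prj1 C X Y = Idn C X"
    and Inj2_Prj2: "X \<in> Ob C \<Longrightarrow> Y \<in> Ob C \<Longrightarrow> Inj2 C X Y \<cdot> Prj2 C X Y = Idn C Y"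
    and Inj1_Prj2: "X \<in> Ob C \<Longrightarrow> Y \<in> Ob C \<Longrightarrow> Inj1 C X Y \<cdot> Prj2 C X Y = Zero C X Y"
    and Inj2_Prj1: "X \<in> Ob C \<Longrightarrow> Y \<in> Ob C \<Longrightarrow> Inj2 C X Y \<cdot> Prj1 C X Y = Zero C Y X"
    and Prj_Inj_sum: "X \<in> Ob C \<Longrightarrow> Y \<in> Ob C \<Longrightarrow>
      Prj1 C X Y \<cdot> Inj1 C X Y \<^bold>+ Prj2 C X Y \<cdot> Inj2 C X Y = Idn C (X \<oplus> Y)"

text \<open>
  \<open>row C f g\<close> is the matrix \<open>(f g) : X \<rightarrow> Y1 \<oplus> Y2\<close>; \<open>col C f g\<close> is the matrix with rows
  \<open>f\<close>, \<open>g\<close>, of type \<open>X1 \<oplus> X2 \<rightarrow> Y\<close>; \<open>mat C f11 f12 f21 f22\<close> is the 2-by-2 matrix listed row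
  by row. Rows are indexed by the source.
\<close>

definition row :: "('o, 'm, 'z) additive_category_scheme \<Rightarrow> 'm \<Rightarrow> 'm \<Rightarrow> 'm" where
  "row C f g = f \<cdot>\<^bsub>C\<^esub> Inj1 C (Cod C f) (Cod C g) \<^bold>+\<^bsub>C\<^esub> g \<cdot>\<^bsub>C\<^esub> Inj2 C (Cod C f) (Cod C g)"

definition col :: "('o, 'm, 'z) additive_category_scheme \<Rightarrow> 'm \<Rightarrow> 'm \<Rightarrow> 'm" where
  "col C f g = Prj1 C (Dom C f) (Dom C g) \<cdot>\<^bsub>C\<^esub> f \<^bold>+\<^bsub>C\<^esub> Prj2 C (Dom C f) (Dom C g) \<cdot>\<^bsub>C\<^esub> g"

definition mat :: "('o, 'm, 'z) additive_category_scheme \<Rightarrow> 'm \<Rightarrow> 'm \<Rightarrow> 'm \<Rightarrow> 'm \<Rightarrow> 'm" where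
  "mat C f11 f12 f21 f22 = col C (row C f11 f12) (row C f21 f22)"


section \<open>Kernels, cokernels and the kernel-cokernel-factorisation\<close>

definition is_kernel :: "('o, 'm, 'z) preadditive_category_scheme \<Rightarrow> 'm \<Rightarrow> 'm \<Rightarrow> bool" where
  "is_kernel C f k \<longleftrightarrow> f \<in> Arr C \<and> k \<in> Arr C \<and> Cod C k = Dom C f \<and>
     k \<cdot>\<^bsub>C\<^esub> f = Zero C (Dom C k) (Cod C f) \<and>
     (\<forall>t\<in>Arr C. Cod C t = Dom C f \<longrightarrow> t \<cdot>\<^bsub>C\<^esub> f = Zero C (Dom C t) (Cod C f) \<longrightarrow>
        (\<exists>!u. u \<in> Hom C (Dom C t) (Dom C k) \<and> u \<cdot>\<^bsub>C\<^esub> k = t))"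

definition is_cokernel :: "('o, 'm, 'z) preadditive_category_scheme \<Rightarrow> 'm \<Rightarrow> 'm \<Rightarrow> bool" where
  "is_cokernel C f c \<longleftrightarrow> f \<in> Arr C \<and> c \<in> Arr C \<and> Dom C c = Cod C f \<and>
     f \<cdot>\<^bsub>C\<^esub> c = Zero C (Dom C f) (Cod C c) \<and>
     (\<forall>t\<in>Arr C. Dom C t = Cod C f \<longrightarrow> f \<cdot>\<^bsub>C\<^esub> t = Zero C (Dom C f) (Cod C t) \<longrightarrow>
        (\<exists>!u. u \<in> Hom C (Cod C c) (Cod C t) \<and> c \<cdot>\<^bsub>C\<^esub> u = t))"

definition kernel_cokernel_factorisation ::
    "('o, 'm, 'z) preadditive_category_scheme \<Rightarrow> 'm \<Rightarrow> 'm \<Rightarrow> 'm \<Rightarrow> 'm \<Rightarrow> 'm \<Rightarrow> bool" where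
  "kernel_cokernel_factorisation C g k c p i \<longleftrightarrow>
     is_kernel C g k \<and> is_cokernel C g c \<and> is_cokernel C k p \<and> is_kernel C c i"

definition is_induced_morphism ::
    "('o, 'm, 'z) preadditive_category_scheme \<Rightarrow> 'm \<Rightarrow> 'm \<Rightarrow> 'm \<Rightarrow> 'm \<Rightarrow> bool" where
  "is_induced_morphism C g p i h \<longleftrightarrow>
     h \<in> Hom C (Cod C p) (Dom C i) \<and> p \<cdot>\<^bsub>C\<^esub> h \<cdot>\<^bsub>C\<^esub> i = g \<and>
     (\<forall>h'\<in>Hom C (Cod C p) (Dom C i). p \<cdot>\<^bsub>C\<^esub> h' \<cdot>\<^bsub>C\<^esub> i = g \<longrightarrow> h' = h)"


section \<open>Quotient categories\<close>

text \<open>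
  \<open>N\<close> is the set of arrows belonging to the ideal. An arrow of the quotient category is a residue
  class, i.e. a nonempty set of parallel arrows of \<open>C\<close>, which determines its domain and codomain.
\<close>

definition residue_class ::
    "('o, 'm, 'z) preadditive_category_scheme \<Rightarrow> 'm set \<Rightarrow> 'm \<Rightarrow> 'm set" where
  "residue_class C N f = {g \<in> Hom C (Dom C f) (Cod C f). g \<^bold>+\<^bsub>C\<^esub> neg C f \<in> N}"

definition quotient_category ::
    "('o, 'm, 'z) preadditive_category_scheme \<Rightarrow> 'm set \<Rightarrow> ('o, 'm set) preadditive_category" where
  "quotient_category C N =
     \<lparr>Ob = Ob C,
      Arr = residue_class C N ` Arr C,
      Dom = (\<lambda>F. the_elem (Dom C ` F)),
      Cod = (\<lambda>F. the_elem (Cod C ` F)),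
      Comp = (\<lambda>F G. \<Union>f\<in>F. \<Union>g\<in>G. residue_class C N (f \<cdot>\<^bsub>C\<^esub> g)),
      Idn = (\<lambda>X. residue_class C N (Idn C X)),
      Add = (\<lambda>F G. \<Union>f\<in>F. \<Union>g\<in>G. residue_class C N (f \<^bold>+\<^bsub>C\<^esub> g)),
      Zero = (\<lambda>X Y. residue_class C N (Zero C X Y))\<rparr>"


section \<open>The Adelman category\<close>

text \<open>
  \<open>Diagram A0 A1 A2 a0 a1\<close> is the diagram with \<open>a0 : A0 \<rightarrow> A1\<close> and \<open>a1 : A1 \<rightarrow> A2\<close>. Morphisms of
  diagrams carry their source and target, since the triple \<open>(f0, f1, f2)\<close> alone does not determine
  the maps of the diagrams.
\<close>

datatype ('o, 'm) diagram =
  Diagram (ob0: 'o) (ob1: 'o) (ob2: 'o) (map0: 'm) (map1: 'm)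

datatype ('o, 'm) diagram_mor =
  Diagram_Mor (src: "('o, 'm) diagram") (tgt: "('o, 'm) diagram")
    (mor0: 'm) (mor1: 'm) (mor2: 'm)

definition is_diagram :: "('o, 'm, 'z) category_scheme \<Rightarrow> ('o, 'm) diagram \<Rightarrow> bool" where
  "is_diagram C A \<longleftrightarrow> ob0 A \<in> Ob C \<and> ob1 A \<in> Ob C \<and> ob2 A \<in> Ob C \<and>
     map0 A \<in> Hom C (ob0 A) (ob1 A) \<and> map1 A \<in> Hom C (ob1 A) (ob2 A)"

definition is_diagram_mor :: "('o, 'm, 'z) category_scheme \<Rightarrow> ('o, 'm) diagram_mor \<Rightarrow> bool" where
  "is_diagram_mor C f \<longleftrightarrow> is_diagram C (src f) \<and> is_diagram C (tgt f) \<and>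
     mor0 f \<in> Hom C (ob0 (src f)) (ob0 (tgt f)) \<and>
     mor1 f \<in> Hom C (ob1 (src f)) (ob1 (tgt f)) \<and>
     mor2 f \<in> Hom C (ob2 (src f)) (ob2 (tgt f)) \<and>
     map0 (src f) \<cdot>\<^bsub>C\<^esub> mor1 f = mor0 f \<cdot>\<^bsub>C\<^esub> map0 (tgt f) \<and>
     map1 (src f) \<cdot>\<^bsub>C\<^esub> mor2 f = mor1 f \<cdot>\<^bsub>C\<^esub> map1 (tgt f)"

definition diagram_category :: "('o, 'm, 'z) preadditive_category_scheme \<Rightarrow>
    (('o, 'm) diagram, ('o, 'm) diagram_mor) preadditive_category" where
  "diagram_category C =
     \<lparr>Ob = {A. is_diagram C A},
      Arr = {f. is_diagram_mor C f},
      Dom = src,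
      Cod = tgt,
      Comp = (\<lambda>f g. Diagram_Mor (src f) (tgt g)
        (mor0 f \<cdot>\<^bsub>C\<^esub> mor0 g) (mor1 f \<cdot>\<^bsub>C\<^esub> mor1 g) (mor2 f \<cdot>\<^bsub>C\<^esub> mor2 g)),
      Idn = (\<lambda>A. Diagram_Mor A A (Idn C (ob0 A)) (Idn C (ob1 A)) (Idn C (ob2 A))),
      Add = (\<lambda>f g. Diagram_Mor (src f) (tgt f)
        (mor0 f \<^bold>+\<^bsub>C\<^esub> mor0 g) (mor1 f \<^bold>+\<^bsub>C\<^esub> mor1 g) (mor2 f \<^bold>+\<^bsub>C\<^esub> mor2 g)),
      Zero = (\<lambda>A B. Diagram_Mor A B
        (Zero C (ob0 A) (ob0 B)) (Zero C (ob1 A) (ob1 B)) (Zero C (ob2 A) (ob2 B)))\<rparr>"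

definition null_homotopic ::
    "('o, 'm, 'z) preadditive_category_scheme \<Rightarrow> ('o, 'm) diagram_mor \<Rightarrow> bool" where
  "null_homotopic C f \<longleftrightarrow>
     (\<exists>s\<in>Hom C (ob1 (src f)) (ob0 (tgt f)). \<exists>t\<in>Hom C (ob2 (src f)) (ob1 (tgt f)).
        s \<cdot>\<^bsub>C\<^esub> map0 (tgt f) \<^bold>+\<^bsub>C\<^esub> map1 (src f) \<cdot>\<^bsub>C\<^esub> t = mor1 f)"

definition null_homotopic_ideal ::
    "('o, 'm, 'z) preadditive_category_scheme \<Rightarrow> ('o, 'm) diagram_mor set" where
  "null_homotopic_ideal C = {f \<in> Arr (diagram_category C). null_homotopic C f}"

definition adelman_category :: "('o, 'm, 'z) preadditive_category_scheme \<Rightarrow>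
    (('o, 'm) diagram, ('o, 'm) diagram_mor set) preadditive_category" where
  "adelman_category C = quotient_category (diagram_category C) (null_homotopic_ideal C)"

definition adelman_class ::
    "('o, 'm, 'z) preadditive_category_scheme \<Rightarrow> ('o, 'm) diagram_mor \<Rightarrow> ('o, 'm) diagram_mor set" where
  "adelman_class C f = residue_class (diagram_category C) (null_homotopic_ideal C) f"


section \<open>Kernel, cokernel and induced morphism of a morphism of diagrams\<close>

definition ker_ob ::
    "('o, 'm, 'z) additive_category_scheme \<Rightarrow> ('o, 'm) diagram_mor \<Rightarrow> ('o, 'm) diagram" where
  "ker_ob C f =
     (let A = src f; A0 = ob0 A; A1 = ob1 A; A2 = ob2 A; a0 = map0 A; a1 = map1 A;
          B = tgt f; B0 = ob0 B; B1 = ob1 B; b0 = map0 B; f1 = mor1 f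
      in Diagram (A0 \<oplus>\<^bsub>C\<^esub> B0) (A1 \<oplus>\<^bsub>C\<^esub> B0) (A2 \<oplus>\<^bsub>C\<^esub> B1)
           (mat C a0 (Zero C A0 B0)
                  (Zero C B0 A1) (Idn C B0))
           (mat C a1 f1
                  (Zero C B0 A2) (neg C b0)))"

definition ker_mor ::
    "('o, 'm, 'z) additive_category_scheme \<Rightarrow> ('o, 'm) diagram_mor \<Rightarrow> ('o, 'm) diagram_mor" where
  "ker_mor C f =
     (let A = src f; A0 = ob0 A; A1 = ob1 A; A2 = ob2 A;
          B = tgt f; B0 = ob0 B; B1 = ob1 B
      in Diagram_Mor (ker_ob C f) A
           (col C (Idn C A0) (Zero C B0 A0))
           (col C (Idn C A1) (Zero C B0 A1))
           (col C (Idn C A2) (Zero C B1 A2)))"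

definition coker_ob ::
    "('o, 'm, 'z) additive_category_scheme \<Rightarrow> ('o, 'm) diagram_mor \<Rightarrow> ('o, 'm) diagram" where
  "coker_ob C f =
     (let A = src f; A1 = ob1 A; A2 = ob2 A; a1 = map1 A;
          B = tgt f; B0 = ob0 B; B1 = ob1 B; B2 = ob2 B; b0 = map0 B; b1 = map1 B; f1 = mor1 f
      in Diagram (B0 \<oplus>\<^bsub>C\<^esub> A1) (B1 \<oplus>\<^bsub>C\<^esub> A2) (B2 \<oplus>\<^bsub>C\<^esub> A2)
           (mat C b0 (Zero C B0 A2)
                  f1 (neg C a1))
           (mat C b1 (Zero C B1 A2)
                  (Zero C A2 B2) (Idn C A2)))"

definition coker_mor ::
    "('o, 'm, 'z) additive_category_scheme \<Rightarrow> ('o, 'm) diagram_mor \<Rightarrow> ('o, 'm) diagram_mor" where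
  "coker_mor C f =
     (let A = src f; A1 = ob1 A; A2 = ob2 A;
          B = tgt f; B0 = ob0 B; B1 = ob1 B; B2 = ob2 B
      in Diagram_Mor B (coker_ob C f)
           (row C (Idn C B0) (Zero C B0 A1))
           (row C (Idn C B1) (Zero C B1 A2))
           (row C (Idn C B2) (Zero C B2 A2)))"

definition I_mor ::
    "('o, 'm, 'z) additive_category_scheme \<Rightarrow> ('o, 'm) diagram_mor \<Rightarrow> ('o, 'm) diagram_mor" where
  "I_mor C f =
     (let A = src f; A0 = ob0 A; A1 = ob1 A; A2 = ob2 A; a0 = map0 A;
          B = tgt f; B0 = ob0 B; B1 = ob1 B; B2 = ob2 B; b1 = map1 B;
          f0 = mor0 f; f1 = mor1 f; f2 = mor2 f
      in Diagram_Mor (coker_ob C (ker_mor C f)) (ker_ob C (coker_mor C f))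
           (mat C f0 (row C (Zero C A0 B0) a0)
                  (col C (Zero C A1 B0) (Idn C B0))
                  (mat C (Zero C A1 B0) (Idn C A1)
                         (Zero C B0 B0) (Zero C B0 A1)))
           (mat C f1 (row C (Zero C A1 B0) (Idn C A1))
                  (col C (Zero C A2 B1) (Idn C B1))
                  (Zero C (A2 \<oplus>\<^bsub>C\<^esub> B1) (B0 \<oplus>\<^bsub>C\<^esub> A1)))
           (mat C f2 (row C (Zero C A2 B1) (Idn C A2))
                  (col C (Zero C A2 B2) b1)
                  (mat C (Zero C A2 B1) (Zero C A2 A2)
                         (Idn C B1) (Zero C B1 A2))))"

definition J_mor ::
    "('o, 'm, 'z) additive_category_scheme \<Rightarrow> ('o, 'm) diagram_mor \<Rightarrow> ('o, 'm) diagram_mor" where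
  "J_mor C f =
     (let A = src f; A0 = ob0 A; A1 = ob1 A; A2 = ob2 A; a1 = map1 A;
          B = tgt f; B0 = ob0 B; B1 = ob1 B; B2 = ob2 B; b0 = map0 B; f1 = mor1 f
      in Diagram_Mor (ker_ob C (coker_mor C f)) (coker_ob C (ker_mor C f))
           (mat C (Zero C B0 A0) (row C (Zero C B0 A1) (Idn C B0))
                  (Zero C (B0 \<oplus>\<^bsub>C\<^esub> A1) A0)
                  (mat C (Zero C B0 A1) (neg C (Idn C B0))
                         (Idn C A1) (Zero C A1 B0)))
           (mat C (Zero C B1 A1) (row C (Zero C B1 A2) (Idn C B1))
                  (col C (Zero C B0 A1) (Idn C A1))
                  (mat C (Zero C B0 A2) (neg C b0)
                         (neg C a1) (neg C f1)))
           (mat C (Zero C B2 A2) (Zero C B2 (A2 \<oplus>\<^bsub>C\<^esub> B1))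
                  (col C (Zero C B1 A2) (Idn C A2))
                  (mat C (Zero C B1 A2) (Idn C B1)
                         (neg C (Idn C A2)) (Zero C A2 B1))))"

end

theory Submission
  imports Defs
begin

text \<open>
  A lift of a test morphism along \<open>ker_mor C f\<close> is built from the two components of a null-homotopy
  of its composite with \<open>f\<close>, and a null-homotopy of \<open>u \<cdot> ker_mor C f\<close> extends to one of \<open>u\<close>, so that
  \<open>ker_mor C f\<close> is a kernel modulo homotopy; cokernels are dual. The composite of \<open>coker_mor C (ker_mor C f)\<close>,
  \<open>I_mor C f\<close> and \<open>ker_mor C (coker_mor C f)\<close> equals \<open>f\<close> already before passing to residue classes,
  whereas \<open>I_mor C f\<close> and \<open>J_mor C f\<close> are inverse only up to the homotopies
  \<open>s = 0\<close>, \<open>t = ((0, (-1, 0)), ((0, (-1, 0)), (0, (0, 0))))\<close> and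
  \<open>s = ((0, (0, 0)), ((-1, (-1, 0)), (0, (0, 0))))\<close>, \<open>t = 0\<close> (matrices listed row by row).
  Uniqueness of the induced morphism holds because cokernels are epimorphisms and kernels are
  monomorphisms.
\<close>

section \<open>Preadditive categories\<close>

text \<open>
  The axioms are restated with conditions on \<open>Dom\<close> and \<open>Cod\<close> in place of membership in \<open>Hom C X Y\<close>:
  then no objects \<open>X\<close>, \<open>Y\<close> have to be guessed when the simplifier discharges side conditions.
\<close>

lemma in_Hom_iff: "f \<in> Hom C X Y \<longleftrightarrow> f \<in> Arr C \<and> Dom C f = X \<and> Cod C f = Y"
  by (auto simp: Hom_def)

context category
begin

lemma Dom_Ob [simp]: "f \<in> Arr C \<Longrightarrow> Dom C f \<in> Ob C"
  by (rule Dom_in_Ob)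

lemma Cod_Ob [simp]: "f \<in> Arr C \<Longrightarrow> Cod C f \<in> Ob C"
  by (rule Cod_in_Ob)

lemma Comp_type [simp]:
  assumes "f \<in> Arr C" "g \<in> Arr C" "Cod C f = Dom C g"
  shows "f \<cdot> g \<in> Arr C" "Dom C (f \<cdot> g) = Dom C f" "Cod C (f \<cdot> g) = Cod C g"
  using Comp_in_Hom[of f "Dom C f" "Cod C f" g "Cod C g"] assms by (auto simp: in_Hom_iff)

lemma Idn_type [simp]:
  assumes "X \<in> Ob C"
  shows "Idn C X \<in> Arr C" "Dom C (Idn C X) = X" "Cod C (Idn C X) = X"
  using Idn_in_Hom[OF assms] by (auto simp: in_Hom_iff)

text \<open>Fixes brackets to the right as the normal form of composites. An equation about the
  first two of three factors then no longer matches, so where such an equation is required an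
  instance of associativity is supplied separately.\<close>

lemma Comp_assoc' [simp]:
  "f \<in> Arr C \<Longrightarrow> g \<in> Arr C \<Longrightarrow> h \<in> Arr C \<Longrightarrow> Cod C f = Dom C g \<Longrightarrow> Cod C g = Dom C h \<Longrightarrow>
    (f \<cdot> g) \<cdot> h = f \<cdot> (g \<cdot> h)"
  by (rule Comp_assoc) (auto simp: in_Hom_iff)

lemma Idn_Comp' [simp]: "f \<in> Arr C \<Longrightarrow> Dom C f = X \<Longrightarrow> Idn C X \<cdot> f = f"
  by (rule Idn_Comp) (auto simp: in_Hom_iff)

lemma Comp_Idn' [simp]: "f \<in> Arr C \<Longrightarrow> Cod C f = X \<Longrightarrow> f \<cdot> Idn C X = f"
  by (rule Comp_Idn) (auto simp: in_Hom_iff)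

end

context preadditive_category
begin

text \<open>The group laws on morphisms come from interpreting \<open>comm_group\<close> at a
  suitable \<open>hom_group\<close>; this and the following lemmas translate them into
  \<open>Add\<close>, \<open>Zero\<close> and \<open>neg\<close>.\<close>

lemma Add_type [simp]:
  assumes "f \<in> Arr C" "g \<in> Arr C" "Dom C f = Dom C g" "Cod C f = Cod C g"
  shows "f \<^bold>+ g \<in> Arr C" "Dom C (f \<^bold>+ g) = Dom C g" "Cod C (f \<^bold>+ g) = Cod C g"
proof -
  interpret comm_group "hom_group C (Dom C g) (Cod C g)"
    using assms by (intro hom_group_comm_group) auto
  show "f \<^bold>+ g \<in> Arr C" "Dom C (f \<^bold>+ g) = Dom C g" "Cod C (f \<^bold>+ g) = Cod C g"
    using m_closed[of f g] assms by (auto simp: hom_group_def in_Hom_iff)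
qed

lemma Zero_type [simp]:
  assumes "X \<in> Ob C" "Y \<in> Ob C"
  shows "Zero C X Y \<in> Arr C" "Dom C (Zero C X Y) = X" "Cod C (Zero C X Y) = Y"
proof -
  interpret comm_group "hom_group C X Y"
    using assms by (intro hom_group_comm_group) auto
  show "Zero C X Y \<in> Arr C" "Dom C (Zero C X Y) = X" "Cod C (Zero C X Y) = Y"
    using one_closed by (auto simp: hom_group_def in_Hom_iff)
qed

lemma neg_type [simp]:
  assumes "f \<in> Arr C"
  shows "neg C f \<in> Arr C" "Dom C (neg C f) = Dom C f" "Cod C (neg C f) = Cod C f"
proof -
  interpret comm_group "hom_group C (Dom C f) (Cod C f)"
    using assms by (intro hom_group_comm_group) auto
  have "f \<in> carrier (hom_group C (Dom C f) (Cod C f))"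
    using assms by (auto simp: hom_group_def in_Hom_iff)
  then have "neg C f \<in> carrier (hom_group C (Dom C f) (Cod C f))"
    unfolding neg_def by (rule inv_closed)
  then show "neg C f \<in> Arr C" "Dom C (neg C f) = Dom C f" "Cod C (neg C f) = Cod C f"
    by (auto simp: hom_group_def in_Hom_iff)
qed

lemma Add_assoc:
  assumes "f \<in> Arr C" "g \<in> Arr C" "h \<in> Arr C" "Dom C f = Dom C g" "Cod C f = Cod C g"
    "Dom C g = Dom C h" "Cod C g = Cod C h"
  shows "(f \<^bold>+ g) \<^bold>+ h = f \<^bold>+ (g \<^bold>+ h)"
proof -
  interpret comm_group "hom_group C (Dom C h) (Cod C h)"
    using assms by (intro hom_group_comm_group) auto
  show ?thesis
    using m_assoc[of f g h] assms by (auto simp: hom_group_def in_Hom_iff)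
qed

lemma Add_commute:
  assumes "f \<in> Arr C" "g \<in> Arr C" "Dom C f = Dom C g" "Cod C f = Cod C g"
  shows "f \<^bold>+ g = g \<^bold>+ f"
proof -
  interpret comm_group "hom_group C (Dom C g) (Cod C g)"
    using assms by (intro hom_group_comm_group) auto
  show ?thesis
    using m_comm[of f g] assms by (auto simp: hom_group_def in_Hom_iff)
qed

lemma Add_left_commute:
  assumes "f \<in> Arr C" "g \<in> Arr C" "h \<in> Arr C" "Dom C f = Dom C g" "Cod C f = Cod C g"
    "Dom C g = Dom C h" "Cod C g = Cod C h"
  shows "f \<^bold>+ (g \<^bold>+ h) = g \<^bold>+ (f \<^bold>+ h)"
  using assms Add_assoc[of f g h] Add_assoc[of g f h] Add_commute[of f g] by simp

lemmas Add_ac = Add_assoc Add_commute Add_left_commute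

lemma Zero_Add [simp]:
  assumes "f \<in> Arr C" "Dom C f = X" "Cod C f = Y"
  shows "Zero C X Y \<^bold>+ f = f"
proof -
  interpret comm_group "hom_group C X Y"
    using assms by (intro hom_group_comm_group) auto
  show ?thesis
    using l_one[of f] assms by (auto simp: hom_group_def in_Hom_iff)
qed

lemma Add_Zero [simp]: "f \<in> Arr C \<Longrightarrow> Dom C f = X \<Longrightarrow> Cod C f = Y \<Longrightarrow> f \<^bold>+ Zero C X Y = f"
  using Add_commute[of f "Zero C X Y"] by auto

lemma neg_Add_self [simp]:
  assumes "f \<in> Arr C"
  shows "neg C f \<^bold>+ f = Zero C (Dom C f) (Cod C f)"
proof -
  interpret comm_group "hom_group C (Dom C f) (Cod C f)"
    using assms by (intro hom_group_comm_group) auto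
  have "f \<in> carrier (hom_group C (Dom C f) (Cod C f))"
    using assms by (auto simp: hom_group_def in_Hom_iff)
  from l_inv[OF this] show ?thesis
    by (simp add: hom_group_def neg_def)
qed

lemma Add_neg_self [simp]: "f \<in> Arr C \<Longrightarrow> f \<^bold>+ neg C f = Zero C (Dom C f) (Cod C f)"
  using Add_commute[of f "neg C f"] by auto

lemma neg_Add_cancel [simp]:
  "f \<in> Arr C \<Longrightarrow> g \<in> Arr C \<Longrightarrow> Dom C f = Dom C g \<Longrightarrow> Cod C f = Cod C g \<Longrightarrow> neg C f \<^bold>+ (f \<^bold>+ g) = g"
  using Add_assoc[of "neg C f" f g] by simp

lemma Add_neg_cancel [simp]:
  "f \<in> Arr C \<Longrightarrow> g \<in> Arr C \<Longrightarrow> Dom C f = Dom C g \<Longrightarrow> Cod C f = Cod C g \<Longrightarrow> f \<^bold>+ (neg C f \<^bold>+ g) = g"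
  using Add_assoc[of f "neg C f" g] by simp

text \<open>The behaviour of \<open>neg\<close> on zeros, sums and composites is deduced from here:
  it suffices to add the proposed negative and obtain zero.\<close>

lemma neg_unique:
  assumes "f \<in> Arr C" "g \<in> Arr C" "Dom C f = Dom C g" "Cod C f = Cod C g"
    and "f \<^bold>+ g = Zero C (Dom C g) (Cod C g)"
  shows "g = neg C f"
  using neg_Add_cancel[of f g] assms by simp

lemma neg_neg [simp]: "f \<in> Arr C \<Longrightarrow> neg C (neg C f) = f"
  using neg_unique[of "neg C f" f] by simp

lemma neg_Zero [simp]: "X \<in> Ob C \<Longrightarrow> Y \<in> Ob C \<Longrightarrow> neg C (Zero C X Y) = Zero C X Y"
  using neg_unique[of "Zero C X Y" "Zero C X Y"] by simp

lemma neg_Add [simp]: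
  "f \<in> Arr C \<Longrightarrow> g \<in> Arr C \<Longrightarrow> Dom C f = Dom C g \<Longrightarrow> Cod C f = Cod C g \<Longrightarrow>
    neg C (f \<^bold>+ g) = neg C f \<^bold>+ neg C g"
  using neg_unique[of "f \<^bold>+ g" "neg C f \<^bold>+ neg C g"]
  by (simp add: Add_assoc Add_left_commute[of g "neg C f" "neg C g"])

lemma Comp_Add' [simp]:
  "f \<in> Arr C \<Longrightarrow> g \<in> Arr C \<Longrightarrow> h \<in> Arr C \<Longrightarrow> Cod C f = Dom C g \<Longrightarrow> Dom C g = Dom C h \<Longrightarrow>
    Cod C g = Cod C h \<Longrightarrow> f \<cdot> (g \<^bold>+ h) = f \<cdot> g \<^bold>+ f \<cdot> h"
  by (rule Comp_Add) (auto simp: in_Hom_iff)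

lemma Add_Comp' [simp]:
  "f \<in> Arr C \<Longrightarrow> g \<in> Arr C \<Longrightarrow> h \<in> Arr C \<Longrightarrow> Dom C f = Dom C g \<Longrightarrow> Cod C f = Cod C g \<Longrightarrow>
    Cod C g = Dom C h \<Longrightarrow> (f \<^bold>+ g) \<cdot> h = f \<cdot> h \<^bold>+ g \<cdot> h"
  by (rule Add_Comp) (auto simp: in_Hom_iff)

text \<open>By distributivity the composite \<open>x\<close> satisfies \<open>x + x = x\<close>, and
  adding the negative of \<open>x\<close> leaves zero.\<close>

lemma Comp_Zero [simp]:
  assumes "f \<in> Arr C" "Cod C f = Y" "Z \<in> Ob C"
  shows "f \<cdot> Zero C Y Z = Zero C (Dom C f) Z"
proof -
  have [simp]: "Y \<in> Ob C" using assms by auto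
  have "f \<cdot> Zero C Y Z \<^bold>+ f \<cdot> Zero C Y Z = f \<cdot> Zero C Y Z"
    using assms Comp_Add'[of f "Zero C Y Z" "Zero C Y Z"] by (simp del: Comp_Add')
  then show ?thesis
    using assms neg_Add_cancel[of "f \<cdot> Zero C Y Z" "f \<cdot> Zero C Y Z"] by (simp del: neg_Add_cancel)
qed

lemma Zero_Comp [simp]:
  assumes "f \<in> Arr C" "Dom C f = Y" "X \<in> Ob C"
  shows "Zero C X Y \<cdot> f = Zero C X (Cod C f)"
proof -
  have [simp]: "Y \<in> Ob C" using assms by auto
  have "Zero C X Y \<cdot> f \<^bold>+ Zero C X Y \<cdot> f = Zero C X Y \<cdot> f"
    using assms Add_Comp'[of "Zero C X Y" "Zero C X Y" f] by (simp del: Add_Comp')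
  then show ?thesis
    using assms neg_Add_cancel[of "Zero C X Y \<cdot> f" "Zero C X Y \<cdot> f"] by (simp del: neg_Add_cancel)
qed

lemma Comp_neg [simp]:
  "f \<in> Arr C \<Longrightarrow> g \<in> Arr C \<Longrightarrow> Cod C f = Dom C g \<Longrightarrow> f \<cdot> neg C g = neg C (f \<cdot> g)"
  \<comment> \<open>Distributivity is read backwards: the sum of the two composites becomes
    \<open>f\<close> followed by \<open>g\<close> plus its negative, which is zero.\<close>
  by (rule neg_unique) (simp_all flip: Comp_Add')

lemma neg_Comp [simp]:
  "f \<in> Arr C \<Longrightarrow> g \<in> Arr C \<Longrightarrow> Cod C f = Dom C g \<Longrightarrow> neg C f \<cdot> g = neg C (f \<cdot> g)"
  by (rule neg_unique) (simp_all flip: Add_Comp')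

section \<open>Cancellation of kernels and cokernels, and the induced morphism\<close>

lemma is_kernelD:
  "is_kernel C f k \<Longrightarrow> t \<in> Arr C \<Longrightarrow> Cod C t = Dom C f \<Longrightarrow> t \<cdot> f = Zero C (Dom C t) (Cod C f) \<Longrightarrow>
    \<exists>!u. u \<in> Hom C (Dom C t) (Dom C k) \<and> u \<cdot> k = t"
  by (simp add: is_kernel_def)

lemma is_cokernelD:
  "is_cokernel C f c \<Longrightarrow> t \<in> Arr C \<Longrightarrow> Dom C t = Cod C f \<Longrightarrow> f \<cdot> t = Zero C (Dom C f) (Cod C t) \<Longrightarrow>
    \<exists>!u. u \<in> Hom C (Cod C c) (Cod C t) \<and> c \<cdot> u = t"
  by (simp add: is_cokernel_def)

text \<open>Both \<open>u\<close> and \<open>v\<close> lift the same morphism along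
  \<open>k\<close>, and that morphism is annihilated by \<open>f\<close>, so uniqueness of lifts
  applies. That \<open>u\<close> and \<open>v\<close> share a domain is read off from the
  equation.\<close>

lemma kernel_cancel:
  assumes k: "is_kernel C f k" and "u \<in> Arr C" "v \<in> Arr C" "Cod C u = Dom C k" "Cod C v = Dom C k"
    and eq: "u \<cdot> k = v \<cdot> k"
  shows "u = v"
proof -
  have [simp]: "f \<in> Arr C" "k \<in> Arr C" "Cod C k = Dom C f" "k \<cdot> f = Zero C (Dom C k) (Cod C f)"
    using k by (auto simp: is_kernel_def)
  have "Dom C u = Dom C v"
    using assms(2-5) Comp_type(2)[of u k] Comp_type(2)[of v k] eq by simp
  moreover have "\<exists>!w. w \<in> Hom C (Dom C (u \<cdot> k)) (Dom C k) \<and> w \<cdot> k = u \<cdot> k"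
    by (rule is_kernelD[OF k]) (use assms(2,4) in auto)
  ultimately show ?thesis
    using assms by (auto simp: in_Hom_iff)
qed

lemma cokernel_cancel:
  assumes c: "is_cokernel C f c" and "u \<in> Arr C" "v \<in> Arr C" "Dom C u = Cod C c" "Dom C v = Cod C c"
    and eq: "c \<cdot> u = c \<cdot> v"
  shows "u = v"
proof -
  have [simp]: "f \<in> Arr C" "c \<in> Arr C" "Dom C c = Cod C f" "f \<cdot> c = Zero C (Dom C f) (Cod C c)"
    using c by (auto simp: is_cokernel_def)
  \<comment> \<open>Rebracketing exposes \<open>f \<cdot> c\<close>, which is zero; the normal form
    hides it.\<close>
  have "f \<cdot> (c \<cdot> u) = Zero C (Dom C f) (Cod C (c \<cdot> u))"
    using Comp_assoc'[of f c u] assms(2,4) by (simp del: Comp_assoc')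
  moreover have "Cod C u = Cod C v"
    using assms(2-5) Comp_type(3)[of c u] Comp_type(3)[of c v] eq by simp
  ultimately have "\<exists>!w. w \<in> Hom C (Cod C c) (Cod C (c \<cdot> u)) \<and> c \<cdot> w = c \<cdot> u"
    by (intro is_cokernelD[OF c]) (use assms(2,4) in auto)
  then show ?thesis
    using assms \<open>Cod C u = Cod C v\<close> by (auto simp: in_Hom_iff)
qed

text \<open>The factor \<open>h\<close> is supplied from outside, here by explicit matrices, so only
  its uniqueness is left: cancel \<open>i\<close> on the right and then \<open>p\<close> on the
  left.\<close>

lemma is_induced_morphismI:
  assumes fac: "kernel_cokernel_factorisation C g k c p i"
    and h: "h \<in> Hom C (Cod C p) (Dom C i)" "p \<cdot> h \<cdot> i = g"
  shows "is_induced_morphism C g p i h"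
  unfolding is_induced_morphism_def
proof (intro conjI ballI impI)
  have p: "is_cokernel C k p" and i: "is_kernel C c i"
    using fac by (auto simp: kernel_cokernel_factorisation_def)
  fix h' assume h': "h' \<in> Hom C (Cod C p) (Dom C i)" "p \<cdot> h' \<cdot> i = g"
  have [simp]: "p \<in> Arr C" "i \<in> Arr C"
    using p i by (auto simp: is_cokernel_def is_kernel_def)
  have "p \<cdot> h' = p \<cdot> h"
    by (rule kernel_cancel[OF i]) (use h h' in \<open>auto simp: in_Hom_iff\<close>)
  then show "h' = h"
    by (rule cokernel_cancel[OF p, rotated -1]) (use h h' in \<open>auto simp: in_Hom_iff\<close>)
qed (use h in auto)

end

section \<open>Matrices of morphisms\<close>

context additive_category
begin

lemma DSum_Ob [simp]: "X \<in> Ob C \<Longrightarrow> Y \<in> Ob C \<Longrightarrow> X \<oplus> Y \<in> Ob C"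
  by (rule DSum_in_Ob)

lemma Inj_Prj_type [simp]:
  assumes "X \<in> Ob C" "Y \<in> Ob C"
  shows "Inj1 C X Y \<in> Arr C" "Dom C (Inj1 C X Y) = X" "Cod C (Inj1 C X Y) = X \<oplus> Y"
    and "Inj2 C X Y \<in> Arr C" "Dom C (Inj2 C X Y) = Y" "Cod C (Inj2 C X Y) = X \<oplus> Y"
    and "Prj1 C X Y \<in> Arr C" "Dom C (Prj1 C X Y) = X \<oplus> Y" "Cod C (Prj1 C X Y) = X"
    and "Prj2 C X Y \<in> Arr C" "Dom C (Prj2 C X Y) = X \<oplus> Y" "Cod C (Prj2 C X Y) = Y"
  using Inj1_in_Hom[OF assms] Inj2_in_Hom[OF assms] Prj1_in_Hom[OF assms] Prj2_in_Hom[OF assms]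
  by (auto simp: in_Hom_iff)

lemma Inj_Prj [simp]:
  assumes "X \<in> Ob C" "Y \<in> Ob C"
  shows "Inj1 C X Y \<cdot> Prj1 C X Y = Idn C X" "Inj2 C X Y \<cdot> Prj2 C X Y = Idn C Y"
    "Inj1 C X Y \<cdot> Prj2 C X Y = Zero C X Y" "Inj2 C X Y \<cdot> Prj1 C X Y = Zero C Y X"
  using assms by (auto intro: Inj1_Prj1 Inj2_Prj2 Inj1_Prj2 Inj2_Prj1)

text \<open>The biproduct identities once more, in the shape they take inside a composite bracketed
  to the right.\<close>

lemma Inj_Prj_Comp [simp]:
  assumes "X \<in> Ob C" "Y \<in> Ob C" "f \<in> Arr C"
  shows "Dom C f = X \<Longrightarrow> Inj1 C X Y \<cdot> (Prj1 C X Y \<cdot> f) = f"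
    and "Dom C f = Y \<Longrightarrow> Inj2 C X Y \<cdot> (Prj2 C X Y \<cdot> f) = f"
    and "Dom C f = Y \<Longrightarrow> Inj1 C X Y \<cdot> (Prj2 C X Y \<cdot> f) = Zero C X (Cod C f)"
    and "Dom C f = X \<Longrightarrow> Inj2 C X Y \<cdot> (Prj1 C X Y \<cdot> f) = Zero C Y (Cod C f)"
  using assms Comp_assoc'[of "Inj1 C X Y" "Prj1 C X Y" f] Comp_assoc'[of "Inj2 C X Y" "Prj2 C X Y" f]
    Comp_assoc'[of "Inj1 C X Y" "Prj2 C X Y" f] Comp_assoc'[of "Inj2 C X Y" "Prj1 C X Y" f]
  by (simp_all del: Comp_assoc')

lemma row_type [simp]:
  assumes "f \<in> Arr C" "g \<in> Arr C" "Dom C f = Dom C g"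
  shows "row C f g \<in> Arr C" "Dom C (row C f g) = Dom C g" "Cod C (row C f g) = Cod C f \<oplus> Cod C g"
  using assms by (simp_all add: row_def)

lemma col_type [simp]:
  assumes "f \<in> Arr C" "g \<in> Arr C" "Cod C f = Cod C g"
  shows "col C f g \<in> Arr C" "Dom C (col C f g) = Dom C f \<oplus> Dom C g" "Cod C (col C f g) = Cod C g"
  using assms by (simp_all add: col_def)

lemma row_Prj:
  assumes "f \<in> Arr C" "g \<in> Arr C" "Dom C f = Dom C g"
  shows "row C f g \<cdot> Prj1 C (Cod C f) (Cod C g) = f" "row C f g \<cdot> Prj2 C (Cod C f) (Cod C g) = g"
  using assms by (simp_all add: row_def)

lemma Inj_col:
  assumes "f \<in> Arr C" "g \<in> Arr C" "Cod C f = Cod C g"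
  shows "Inj1 C (Dom C f) (Dom C g) \<cdot> col C f g = f" "Inj2 C (Dom C f) (Dom C g) \<cdot> col C f g = g"
  using assms by (simp_all add: col_def)

text \<open>The projections recover the entries. As a rewrite rule this reduces an equation of
  matrices to equations of entries.\<close>

lemma row_eq_iff [simp]:
  assumes "f \<in> Arr C" "g \<in> Arr C" "Dom C f = Dom C g" "f' \<in> Arr C" "g' \<in> Arr C" "Dom C f' = Dom C g'"
    and "Cod C f = Cod C f'" "Cod C g = Cod C g'"
  shows "row C f g = row C f' g' \<longleftrightarrow> f = f' \<and> g = g'"
  using assms row_Prj[of f g] row_Prj[of f' g'] by metis

lemma col_eq_iff [simp]:
  assumes "f \<in> Arr C" "g \<in> Arr C" "Cod C f = Cod C g" "f' \<in> Arr C" "g' \<in> Arr C" "Cod C f' = Cod C g'"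
    and "Dom C f = Dom C f'" "Dom C g = Dom C g'"
  shows "col C f g = col C f' g' \<longleftrightarrow> f = f' \<and> g = g'"
  using assms Inj_col[of f g] Inj_col[of f' g'] by metis

text \<open>Serves to split the middle component of an unknown morphism into a kernel object; the
  entries are its composites with the projections.\<close>

lemma row_cases:
  assumes "f \<in> Arr C" "Cod C f = X \<oplus> Y" "X \<in> Ob C" "Y \<in> Ob C"
  obtains u v where "u \<in> Arr C" "v \<in> Arr C" "Dom C u = Dom C f" "Dom C v = Dom C f"
    "Cod C u = X" "Cod C v = Y" "f = row C u v"
proof
  have "f \<cdot> (Prj1 C X Y \<cdot> Inj1 C X Y \<^bold>+ Prj2 C X Y \<cdot> Inj2 C X Y) = f"
    \<comment> \<open>Distributivity is switched off so that the sum is recognised as an identity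
      before it is multiplied out.\<close>
    using assms by (simp add: Prj_Inj_sum del: Comp_Add')
  then show "f = row C (f \<cdot> Prj1 C X Y) (f \<cdot> Prj2 C X Y)"
    using assms by (simp add: row_def)
qed (use assms in auto)

lemma col_cases:
  assumes "f \<in> Arr C" "Dom C f = X \<oplus> Y" "X \<in> Ob C" "Y \<in> Ob C"
  obtains u v where "u \<in> Arr C" "v \<in> Arr C" "Cod C u = Cod C f" "Cod C v = Cod C f"
    "Dom C u = X" "Dom C v = Y" "f = col C u v"
proof
  have "(Prj1 C X Y \<cdot> Inj1 C X Y \<^bold>+ Prj2 C X Y \<cdot> Inj2 C X Y) \<cdot> f = f"
    using assms by (simp add: Prj_Inj_sum del: Add_Comp')
  then show "f = col C (Inj1 C X Y \<cdot> f) (Inj2 C X Y \<cdot> f)"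
    using assms by (simp add: col_def)
qed (use assms in auto)

lemma Comp_row [simp]:
  "f \<in> Arr C \<Longrightarrow> g \<in> Arr C \<Longrightarrow> h \<in> Arr C \<Longrightarrow> Cod C f = Dom C g \<Longrightarrow> Dom C g = Dom C h \<Longrightarrow>
    f \<cdot> row C g h = row C (f \<cdot> g) (f \<cdot> h)"
  by (simp add: row_def)

lemma col_Comp [simp]:
  "f \<in> Arr C \<Longrightarrow> g \<in> Arr C \<Longrightarrow> h \<in> Arr C \<Longrightarrow> Cod C f = Cod C g \<Longrightarrow> Cod C g = Dom C h \<Longrightarrow>
    col C f g \<cdot> h = col C (f \<cdot> h) (g \<cdot> h)"
  by (simp add: col_def)

lemma row_col [simp]:
  "f \<in> Arr C \<Longrightarrow> g \<in> Arr C \<Longrightarrow> h \<in> Arr C \<Longrightarrow> k \<in> Arr C \<Longrightarrow> Dom C f = Dom C g \<Longrightarrow> Cod C h = Cod C k \<Longrightarrow>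
    Cod C f = Dom C h \<Longrightarrow> Cod C g = Dom C k \<Longrightarrow> row C f g \<cdot> col C h k = f \<cdot> h \<^bold>+ g \<cdot> k"
  by (simp add: row_def col_def)

lemma row_Add [simp]:
  "f \<in> Arr C \<Longrightarrow> g \<in> Arr C \<Longrightarrow> h \<in> Arr C \<Longrightarrow> k \<in> Arr C \<Longrightarrow> Dom C f = Dom C g \<Longrightarrow> Dom C h = Dom C k \<Longrightarrow>
    Dom C g = Dom C h \<Longrightarrow> Cod C f = Cod C h \<Longrightarrow> Cod C g = Cod C k \<Longrightarrow>
    row C f g \<^bold>+ row C h k = row C (f \<^bold>+ h) (g \<^bold>+ k)"
  by (simp add: row_def Add_ac)

lemma col_Add [simp]:
  "f \<in> Arr C \<Longrightarrow> g \<in> Arr C \<Longrightarrow> h \<in> Arr C \<Longrightarrow> k \<in> Arr C \<Longrightarrow> Cod C f = Cod C g \<Longrightarrow> Cod C h = Cod C k \<Longrightarrow>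
    Cod C g = Cod C h \<Longrightarrow> Dom C f = Dom C h \<Longrightarrow> Dom C g = Dom C k \<Longrightarrow>
    col C f g \<^bold>+ col C h k = col C (f \<^bold>+ h) (g \<^bold>+ k)"
  by (simp add: col_def Add_ac)

lemma neg_row [simp]:
  "f \<in> Arr C \<Longrightarrow> g \<in> Arr C \<Longrightarrow> Dom C f = Dom C g \<Longrightarrow> neg C (row C f g) = row C (neg C f) (neg C g)"
  by (simp add: row_def)

lemma neg_col [simp]:
  "f \<in> Arr C \<Longrightarrow> g \<in> Arr C \<Longrightarrow> Cod C f = Cod C g \<Longrightarrow> neg C (col C f g) = col C (neg C f) (neg C g)"
  by (simp add: col_def)

lemma Zero_row:
  "X \<in> Ob C \<Longrightarrow> Y \<in> Ob C \<Longrightarrow> Z \<in> Ob C \<Longrightarrow> Zero C X (Y \<oplus> Z) = row C (Zero C X Y) (Zero C X Z)"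
  by (simp add: row_def)

lemma Zero_col:
  "X \<in> Ob C \<Longrightarrow> Y \<in> Ob C \<Longrightarrow> Z \<in> Ob C \<Longrightarrow> Zero C (X \<oplus> Y) Z = col C (Zero C X Z) (Zero C Y Z)"
  by (simp add: col_def)

lemma Idn_DSum:
  "X \<in> Ob C \<Longrightarrow> Y \<in> Ob C \<Longrightarrow>
    Idn C (X \<oplus> Y) = col C (row C (Idn C X) (Zero C X Y)) (row C (Zero C Y X) (Idn C Y))"
  by (simp add: row_def col_def Prj_Inj_sum)

text \<open>The two readings of a 2-by-2 matrix agree; the orientation makes columns of rows the
  normal form.\<close>

lemma row_of_cols:
  "f \<in> Arr C \<Longrightarrow> g \<in> Arr C \<Longrightarrow> h \<in> Arr C \<Longrightarrow> k \<in> Arr C \<Longrightarrow> Cod C f = Cod C g \<Longrightarrow> Cod C h = Cod C k \<Longrightarrow>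
    Dom C f = Dom C h \<Longrightarrow> Dom C g = Dom C k \<Longrightarrow>
    row C (col C f g) (col C h k) = col C (row C f h) (row C g k)"
  by (simp add: row_def col_def Add_ac)

text \<open>With the rules for products and sums, these bring nested block matrices into normal
  form, zero and identity blocks included, so that a matrix identity splits into identities of
  entries.\<close>

lemmas matrix_simps = mat_def Zero_row Zero_col Idn_DSum row_of_cols

end

section \<open>Quotients by ideals\<close>

locale preadditive_ideal = preadditive_category C
  for C :: "('o, 'm, 'z) preadditive_category_scheme" (structure) +
  fixes N :: "'m set"
  assumes ideal_Arr: "n \<in> N \<Longrightarrow> n \<in> Arr C"
    and ideal_Zero [simp]: "X \<in> Ob C \<Longrightarrow> Y \<in> Ob C \<Longrightarrow> Zero C X Y \<in> N"
    and ideal_Add: "m \<in> N \<Longrightarrow> n \<in> N \<Longrightarrow> Dom C m = Dom C n \<Longrightarrow> Cod C m = Cod C n \<Longrightarrow> m \<^bold>+ n \<in> N"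
    and ideal_Comp_left: "f \<in> Arr C \<Longrightarrow> n \<in> N \<Longrightarrow> Cod C f = Dom C n \<Longrightarrow> f \<cdot> n \<in> N"
    and ideal_Comp_right: "n \<in> N \<Longrightarrow> f \<in> Arr C \<Longrightarrow> Cod C n = Dom C f \<Longrightarrow> n \<cdot> f \<in> N"
begin

abbreviation Q :: "('o, 'm set) preadditive_category" where
  "Q \<equiv> quotient_category C N"

abbreviation cls :: "'m \<Rightarrow> 'm set" where
  "cls \<equiv> residue_class C N"

definition cong :: "'m \<Rightarrow> 'm \<Rightarrow> bool" where
  "cong f g \<longleftrightarrow> f \<in> Arr C \<and> g \<in> Arr C \<and> Dom C f = Dom C g \<and> Cod C f = Cod C g \<and> f \<^bold>+ neg C g \<in> N"

text \<open>Negation is composition with a negated identity, so it follows from closure under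
  composition.\<close>

lemma ideal_neg:
  assumes "n \<in> N"
  shows "neg C n \<in> N"
proof -
  note [simp] = ideal_Arr[OF assms]
  have "neg C (Idn C (Dom C n)) \<cdot> n \<in> N"
    using assms by (intro ideal_Comp_left) simp_all
  then show ?thesis
    by simp
qed

lemma cong_refl: "f \<in> Arr C \<Longrightarrow> cong f f"
  by (simp add: cong_def)

lemma cong_sym:
  assumes "cong f g"
  shows "cong g f"
proof -
  have "neg C (f \<^bold>+ neg C g) = g \<^bold>+ neg C f"
    using assms by (simp add: cong_def Add_commute[of g "neg C f"])
  then show ?thesis
    using assms ideal_neg[of "f \<^bold>+ neg C g"] by (simp add: cong_def)
qed

lemma cong_trans:
  assumes "cong f g" "cong g h"
  shows "cong f h"
proof -
  have "(f \<^bold>+ neg C g) \<^bold>+ (g \<^bold>+ neg C h) = f \<^bold>+ neg C h"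
    using assms by (simp add: cong_def Add_assoc)
  then show ?thesis
    using assms ideal_Add[of "f \<^bold>+ neg C g" "g \<^bold>+ neg C h"] by (simp add: cong_def)
qed

lemma cong_Add:
  assumes "cong f f'" "cong g g'" "Dom C f = Dom C g" "Cod C f = Cod C g"
  shows "cong (f \<^bold>+ g) (f' \<^bold>+ g')"
proof -
  have "(f \<^bold>+ neg C f') \<^bold>+ (g \<^bold>+ neg C g') = (f \<^bold>+ g) \<^bold>+ neg C (f' \<^bold>+ g')"
    using assms by (simp add: cong_def Add_ac)
  then show ?thesis
    using assms ideal_Add[of "f \<^bold>+ neg C f'" "g \<^bold>+ neg C g'"] by (simp add: cong_def)
qed

text \<open>The factors are exchanged one at a time, so that each summand of the difference contains
  a factor in \<open>N\<close>.\<close>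

lemma cong_Comp:
  assumes "cong f f'" "cong g g'" "Cod C f = Dom C g"
  shows "cong (f \<cdot> g) (f' \<cdot> g')"
proof -
  have "f \<cdot> (g \<^bold>+ neg C g') \<^bold>+ (f \<^bold>+ neg C f') \<cdot> g' = f \<cdot> g \<^bold>+ neg C (f' \<cdot> g')"
    using assms by (simp add: cong_def Add_assoc)
  moreover have "f \<cdot> (g \<^bold>+ neg C g') \<in> N" "(f \<^bold>+ neg C f') \<cdot> g' \<in> N"
    using assms by (intro ideal_Comp_left ideal_Comp_right; simp add: cong_def)+
  ultimately show ?thesis
    using assms ideal_Add[of "f \<cdot> (g \<^bold>+ neg C g')" "(f \<^bold>+ neg C f') \<cdot> g'"] by (simp add: cong_def)
qed

lemma residue_class_conv_cong: "f \<in> Arr C \<Longrightarrow> cls f = {g. cong g f}"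
  by (auto simp: residue_class_def cong_def in_Hom_iff)

lemma residue_class_eq_iff: "f \<in> Arr C \<Longrightarrow> g \<in> Arr C \<Longrightarrow> cls f = cls g \<longleftrightarrow> cong f g"
  by (auto simp: residue_class_conv_cong set_eq_iff intro: cong_refl cong_sym cong_trans)

text \<open>Operations of the quotient are unions over all representatives; such a union collapses
  once its members do not depend on the representative.\<close>

lemma residue_class_image_const:
  assumes "f \<in> Arr C" and "\<And>g. cong g f \<Longrightarrow> h g = h f"
  shows "(\<Union>g\<in>cls f. h g) = h f"
  unfolding residue_class_conv_cong[OF assms(1)]
  by (rule SUP_eq_const) (use cong_refl[OF assms(1)] in blast, rule assms(2), simp)

lemma Ob_Q [simp]: "Ob Q = Ob C"
  by (simp add: quotient_category_def)

lemma Arr_Q: "Arr Q = cls ` Arr C"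
  by (simp add: quotient_category_def)

lemma Arr_Q_I [simp]: "f \<in> Arr C \<Longrightarrow> cls f \<in> Arr Q"
  by (simp add: Arr_Q)

lemma Dom_Q [simp]:
  assumes "f \<in> Arr C"
  shows "Dom Q (cls f) = Dom C f"
proof -
  \<comment> \<open>\<open>Dom Q\<close> is \<open>the_elem\<close> of this image, so it has to be a
    singleton; reflexivity makes it nonempty.\<close>
  have "Dom C ` cls f = {Dom C f}"
    using assms cong_refl[of f] by (auto simp: residue_class_conv_cong) (auto simp: cong_def)
  then show ?thesis
    by (simp add: quotient_category_def)
qed

lemma Cod_Q [simp]:
  assumes "f \<in> Arr C"
  shows "Cod Q (cls f) = Cod C f"
proof -
  have "Cod C ` cls f = {Cod C f}"
    using assms cong_refl[of f] by (auto simp: residue_class_conv_cong) (auto simp: cong_def)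
  then show ?thesis
    by (simp add: quotient_category_def)
qed

lemma Comp_Q [simp]:
  assumes "f \<in> Arr C" "g \<in> Arr C" "Cod C f = Dom C g"
  shows "cls f \<cdot>\<^bsub>Q\<^esub> cls g = cls (f \<cdot> g)"
proof -
  have "cls f \<cdot>\<^bsub>Q\<^esub> cls g = (\<Union>f'\<in>cls f. \<Union>g'\<in>cls g. cls (f' \<cdot> g'))"
    by (simp add: quotient_category_def)
  \<comment> \<open>The inner union is collapsed for an arbitrary representative of the first class,
    the outer one afterwards.\<close>
  also have "\<dots> = (\<Union>f'\<in>cls f. cls (f \<cdot> g))"
  proof (rule SUP_cong)
    fix f' assume "f' \<in> cls f"
    then have "cong f' f"
      using assms by (simp add: residue_class_conv_cong)
    then have "cls (f' \<cdot> g') = cls (f \<cdot> g)" if "cong g' g" for g'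
      using that assms cong_Comp[of f' f g' g] by (subst residue_class_eq_iff) (auto simp: cong_def)
    then show "(\<Union>g'\<in>cls g. cls (f' \<cdot> g')) = cls (f \<cdot> g)"
      using assms cong_refl by (subst residue_class_image_const) auto
  qed simp
  also have "\<dots> = cls (f \<cdot> g)"
    using assms by (subst residue_class_image_const) auto
  finally show ?thesis .
qed

lemma Add_Q [simp]:
  assumes "f \<in> Arr C" "g \<in> Arr C" "Dom C f = Dom C g" "Cod C f = Cod C g"
  shows "cls f \<^bold>+\<^bsub>Q\<^esub> cls g = cls (f \<^bold>+ g)"
proof -
  have "cls f \<^bold>+\<^bsub>Q\<^esub> cls g = (\<Union>f'\<in>cls f. \<Union>g'\<in>cls g. cls (f' \<^bold>+ g'))"
    by (simp add: quotient_category_def)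
  also have "\<dots> = (\<Union>f'\<in>cls f. cls (f \<^bold>+ g))"
  proof (rule SUP_cong)
    fix f' assume "f' \<in> cls f"
    then have "cong f' f"
      using assms by (simp add: residue_class_conv_cong)
    then have "cls (f' \<^bold>+ g') = cls (f \<^bold>+ g)" if "cong g' g" for g'
      using that assms cong_Add[of f' f g' g] by (subst residue_class_eq_iff) (auto simp: cong_def)
    then show "(\<Union>g'\<in>cls g. cls (f' \<^bold>+ g')) = cls (f \<^bold>+ g)"
      using assms cong_refl by (subst residue_class_image_const) auto
  qed simp
  also have "\<dots> = cls (f \<^bold>+ g)"
    using assms by (subst residue_class_image_const) auto
  finally show ?thesis .
qed

lemma Idn_Q [simp]: "Idn Q X = cls (Idn C X)"
  by (simp add: quotient_category_def)

lemma Zero_Q [simp]: "Zero Q X Y = cls (Zero C X Y)"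
  by (simp add: quotient_category_def)

lemma Hom_Q: "Hom Q X Y = cls ` Hom C X Y"
  by (auto simp: in_Hom_iff Arr_Q)

lemma residue_class_eq_Zero_iff:
  "f \<in> Arr C \<Longrightarrow> X = Dom C f \<Longrightarrow> Y = Cod C f \<Longrightarrow> cls f = cls (Zero C X Y) \<longleftrightarrow> f \<in> N"
  by (subst residue_class_eq_iff) (auto simp: cong_def)

text \<open>Every arrow of \<open>Q\<close> is the class of an arrow, and all operations are
  computed on representatives, so the axioms carry over. Only additive inverses, in the case of the
  hom groups, require a witness.\<close>

lemma preadditive_category_Q: "preadditive_category Q"
proof (intro preadditive_category.intro category.intro preadditive_category_axioms.intro, goal_cases)
  case (8 X Y)
  have "\<exists>F'\<in>Hom Q X Y. F' \<^bold>+\<^bsub>Q\<^esub> F = Zero Q X Y" if F: "F \<in> Hom Q X Y" for F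
  proof -
    obtain f where "f \<in> Hom C X Y" "F = cls f"
      using F by (auto simp: Hom_Q)
    then show ?thesis
      by (intro bexI[of _ "cls (neg C f)"]) (auto simp: in_Hom_iff)
  qed
  then show ?case
    using 8 by (intro comm_groupI)
      (auto simp: hom_group_def Hom_Q in_Hom_iff Add_ac)
qed (auto simp: Arr_Q Hom_Q in_Hom_iff)

text \<open>Lifts are asked to exist strictly in \<open>C\<close>. For uniqueness modulo
  \<open>N\<close>, the difference of two lifts composed with \<open>k\<close> lies in
  \<open>N\<close>, and \<open>mono\<close> then places the difference itself in
  \<open>N\<close>.\<close>

lemma is_kernel_residue_classI:
  assumes fk: "f \<in> Arr C" "k \<in> Arr C" "Cod C k = Dom C f" "k \<cdot> f \<in> N"
    and lift: "\<And>t. t \<in> Arr C \<Longrightarrow> Cod C t = Dom C f \<Longrightarrow> t \<cdot> f \<in> N \<Longrightarrow>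
      \<exists>u\<in>Hom C (Dom C t) (Dom C k). u \<cdot> k = t"
    and mono: "\<And>u. u \<in> Arr C \<Longrightarrow> Cod C u = Dom C k \<Longrightarrow> u \<cdot> k \<in> N \<Longrightarrow> u \<in> N"
  shows "is_kernel Q (cls f) (cls k)"
  unfolding is_kernel_def
proof (intro conjI ballI impI)
  show "cls k \<cdot>\<^bsub>Q\<^esub> cls f = Zero Q (Dom Q (cls k)) (Cod Q (cls f))"
    using fk by (simp add: residue_class_eq_Zero_iff)
next
  fix T assume T: "T \<in> Arr Q" "Cod Q T = Dom Q (cls f)"
    "T \<cdot>\<^bsub>Q\<^esub> cls f = Zero Q (Dom Q T) (Cod Q (cls f))"
  then obtain t where t: "t \<in> Arr C" "T = cls t"
    by (auto simp: Arr_Q)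
  then obtain u where u: "u \<in> Hom C (Dom C t) (Dom C k)" "u \<cdot> k = t"
    using T lift[of t] fk by (auto simp: residue_class_eq_Zero_iff)
  show "\<exists>!U. U \<in> Hom Q (Dom Q T) (Dom Q (cls k)) \<and> U \<cdot>\<^bsub>Q\<^esub> cls k = T"
  proof (rule ex1I[of _ "cls u"])
    show "cls u \<in> Hom Q (Dom Q T) (Dom Q (cls k)) \<and> cls u \<cdot>\<^bsub>Q\<^esub> cls k = T"
      using u t fk by (auto simp: in_Hom_iff)
  next
    fix V assume V: "V \<in> Hom Q (Dom Q T) (Dom Q (cls k)) \<and> V \<cdot>\<^bsub>Q\<^esub> cls k = T"
    then obtain v where v: "v \<in> Hom C (Dom C t) (Dom C k)" "V = cls v"
      using t fk by (auto simp: Hom_Q)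
    have "cls (v \<cdot> k) = cls (u \<cdot> k)"
      using V u t v fk by (simp add: in_Hom_iff)
    then have "cong (v \<cdot> k) (u \<cdot> k)"
      using u(1) v fk by (simp add: in_Hom_iff residue_class_eq_iff)
    then have "(v \<^bold>+ neg C u) \<cdot> k \<in> N"
      using u(1) v fk by (auto simp: cong_def in_Hom_iff)
    then have "v \<^bold>+ neg C u \<in> N"
      by (rule mono[rotated 2]) (use u(1) v fk in \<open>auto simp: in_Hom_iff\<close>)
    then show "V = cls u"
      using u(1) v by (auto simp: in_Hom_iff residue_class_eq_iff cong_def)
  qed
qed (use fk in auto)

text \<open>Dual to the kernel criterion: strict extensions, and \<open>epi\<close> applied to the
  difference of two of them.\<close>

lemma is_cokernel_residue_classI:
  assumes fc: "f \<in> Arr C" "c \<in> Arr C" "Dom C c = Cod C f" "f \<cdot> c \<in> N"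
    and extend: "\<And>t. t \<in> Arr C \<Longrightarrow> Dom C t = Cod C f \<Longrightarrow> f \<cdot> t \<in> N \<Longrightarrow>
      \<exists>u\<in>Hom C (Cod C c) (Cod C t). c \<cdot> u = t"
    and epi: "\<And>u. u \<in> Arr C \<Longrightarrow> Dom C u = Cod C c \<Longrightarrow> c \<cdot> u \<in> N \<Longrightarrow> u \<in> N"
  shows "is_cokernel Q (cls f) (cls c)"
  unfolding is_cokernel_def
proof (intro conjI ballI impI)
  show "cls f \<cdot>\<^bsub>Q\<^esub> cls c = Zero Q (Dom Q (cls f)) (Cod Q (cls c))"
    using fc by (simp add: residue_class_eq_Zero_iff)
next
  fix T assume T: "T \<in> Arr Q" "Dom Q T = Cod Q (cls f)"
    "cls f \<cdot>\<^bsub>Q\<^esub> T = Zero Q (Dom Q (cls f)) (Cod Q T)"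
  then obtain t where t: "t \<in> Arr C" "T = cls t"
    by (auto simp: Arr_Q)
  then obtain u where u: "u \<in> Hom C (Cod C c) (Cod C t)" "c \<cdot> u = t"
    using T extend[of t] fc by (auto simp: residue_class_eq_Zero_iff)
  show "\<exists>!U. U \<in> Hom Q (Cod Q (cls c)) (Cod Q T) \<and> cls c \<cdot>\<^bsub>Q\<^esub> U = T"
  proof (rule ex1I[of _ "cls u"])
    show "cls u \<in> Hom Q (Cod Q (cls c)) (Cod Q T) \<and> cls c \<cdot>\<^bsub>Q\<^esub> cls u = T"
      using u t fc by (auto simp: in_Hom_iff)
  next
    fix V assume V: "V \<in> Hom Q (Cod Q (cls c)) (Cod Q T) \<and> cls c \<cdot>\<^bsub>Q\<^esub> V = T"
    then obtain v where v: "v \<in> Hom C (Cod C c) (Cod C t)" "V = cls v"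
      using t fc by (auto simp: Hom_Q)
    have "cls (c \<cdot> v) = cls (c \<cdot> u)"
      using V u t v fc by (simp add: in_Hom_iff)
    then have "cong (c \<cdot> v) (c \<cdot> u)"
      using u(1) v fc by (simp add: in_Hom_iff residue_class_eq_iff)
    then have "c \<cdot> (v \<^bold>+ neg C u) \<in> N"
      using u(1) v fc by (auto simp: cong_def in_Hom_iff)
    then have "v \<^bold>+ neg C u \<in> N"
      by (rule epi[rotated 2]) (use u(1) v fc in \<open>auto simp: in_Hom_iff\<close>)
    then show "V = cls u"
      using u(1) v by (auto simp: in_Hom_iff residue_class_eq_iff cong_def)
  qed
qed (use fc in auto)

end

section \<open>The Adelman category\<close>

lemmas diagram_simps = diagram_category_def is_diagram_mor_def is_diagram_def in_Hom_iff

context preadditive_category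
begin

lemma preadditive_category_diagram: "preadditive_category (diagram_category C)"
proof (intro preadditive_category.intro category.intro preadditive_category_axioms.intro, goal_cases)
  case (3 f X Y g Z)
  then show ?case
    \<comment> \<open>To paste two commuting squares, the square of \<open>f\<close> has to be
      visible at the left end of the composite.\<close>
    using Comp_assoc'[of "map0 X" "mor1 f" "mor1 g"] Comp_assoc'[of "map1 X" "mor2 f" "mor2 g"]
    by (auto simp: diagram_simps simp del: Comp_assoc') (simp_all)
next
  case (8 X Y)
  have "\<exists>g\<in>Hom (diagram_category C) X Y. g \<^bold>+\<^bsub>diagram_category C\<^esub> f = Zero (diagram_category C) X Y"
    if "f \<in> Hom (diagram_category C) X Y" for f
    using that
    by (intro bexI[of _ "Diagram_Mor X Y (neg C (mor0 f)) (neg C (mor1 f)) (neg C (mor2 f))"])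
      (auto simp: diagram_simps)
  then show ?case
    using 8
    by (intro comm_groupI) (auto simp: hom_group_def diagram_simps Add_ac intro!: diagram_mor.expand)
qed (auto simp: diagram_simps intro!: diagram_mor.expand)

text \<open>\<open>neg\<close> is defined as a group inverse, so its components have to be
  identified through uniqueness of inverses.\<close>

lemma diagram_mor_neg:
  assumes "f \<in> Arr (diagram_category C)"
  shows "neg (diagram_category C) f =
    Diagram_Mor (src f) (tgt f) (neg C (mor0 f)) (neg C (mor1 f)) (neg C (mor2 f))"
proof -
  interpret D: preadditive_category "diagram_category C"
    by (rule preadditive_category_diagram)
  show ?thesis
    using assms by (intro D.neg_unique[symmetric]) (auto simp: diagram_simps)
qed

lemma null_homotopic_idealI:
  assumes "f \<in> Arr (diagram_category C)"
    and "s \<in> Arr C" "Dom C s = ob1 (src f)" "Cod C s = ob0 (tgt f)"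
    and "t \<in> Arr C" "Dom C t = ob2 (src f)" "Cod C t = ob1 (tgt f)"
    and "s \<cdot> map0 (tgt f) \<^bold>+ map1 (src f) \<cdot> t = mor1 f"
  shows "f \<in> null_homotopic_ideal C"
  unfolding null_homotopic_ideal_def null_homotopic_def
  using assms(1) by (intro CollectI conjI bexI[of _ s] bexI[of _ t]) (use assms in \<open>auto simp: in_Hom_iff\<close>)

lemma null_homotopic_idealE:
  assumes "f \<in> null_homotopic_ideal C"
  obtains s t where "f \<in> Arr (diagram_category C)"
    "s \<in> Arr C" "Dom C s = ob1 (src f)" "Cod C s = ob0 (tgt f)"
    "t \<in> Arr C" "Dom C t = ob2 (src f)" "Cod C t = ob1 (tgt f)"
    "s \<cdot> map0 (tgt f) \<^bold>+ map1 (src f) \<cdot> t = mor1 f"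
  using assms by (auto simp: null_homotopic_ideal_def null_homotopic_def in_Hom_iff)

text \<open>Homotopies add. Composing with \<open>f\<close> on the left turns \<open>(s, t)\<close>
  into \<open>(f1 s, f2 t)\<close> by the second square of \<open>f\<close>; composing on the right
  turns it into \<open>(s f0, t f1)\<close> by the first square.\<close>

lemma preadditive_ideal_null_homotopic:
  "preadditive_ideal (diagram_category C) (null_homotopic_ideal C)"
proof -
  interpret D: preadditive_category "diagram_category C"
    by (rule preadditive_category_diagram)
  show ?thesis
  proof (intro preadditive_ideal.intro preadditive_category_diagram preadditive_ideal_axioms.intro, goal_cases)
    case (1 n)
    then show ?case
      by (simp add: null_homotopic_ideal_def)
  next
    case (2 X Y)
    then show ?case
      by (intro null_homotopic_idealI[where s = "Zero C (ob1 X) (ob0 Y)" and t = "Zero C (ob2 X) (ob1 Y)"])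
        (simp_all add: diagram_simps)
  next
    case (3 m n)
    obtain s t where n: "n \<in> Arr (diagram_category C)"
      "s \<in> Arr C" "Dom C s = ob1 (src n)" "Cod C s = ob0 (tgt n)"
      "t \<in> Arr C" "Dom C t = ob2 (src n)" "Cod C t = ob1 (tgt n)"
      and n_eq: "s \<cdot> map0 (tgt n) \<^bold>+ map1 (src n) \<cdot> t = mor1 n"
      using 3(2) by (rule null_homotopic_idealE)
    obtain s' t' where m: "m \<in> Arr (diagram_category C)"
      "s' \<in> Arr C" "Dom C s' = ob1 (src m)" "Cod C s' = ob0 (tgt m)"
      "t' \<in> Arr C" "Dom C t' = ob2 (src m)" "Cod C t' = ob1 (tgt m)"
      and m_eq: "s' \<cdot> map0 (tgt m) \<^bold>+ map1 (src m) \<cdot> t' = mor1 m"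
      using 3(1) by (rule null_homotopic_idealE)
    have "(s' \<^bold>+ s) \<cdot> map0 (tgt n) \<^bold>+ map1 (src n) \<cdot> (t' \<^bold>+ t) = mor1 m \<^bold>+ mor1 n"
      using m n 3(3,4) by (simp add: diagram_simps Add_assoc Add_left_commute[of "s \<cdot> map0 (tgt n)"]
          flip: m_eq n_eq)
    then show ?case
      using m n 3(3,4) by (intro null_homotopic_idealI[where s = "s' \<^bold>+ s" and t = "t' \<^bold>+ t"])
        (simp_all add: diagram_simps)
  next
    case (4 f n)
    obtain s t where n: "n \<in> Arr (diagram_category C)"
      "s \<in> Arr C" "Dom C s = ob1 (src n)" "Cod C s = ob0 (tgt n)"
      "t \<in> Arr C" "Dom C t = ob2 (src n)" "Cod C t = ob1 (tgt n)"
      and n_eq: "s \<cdot> map0 (tgt n) \<^bold>+ map1 (src n) \<cdot> t = mor1 n"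
      using 4(2) by (rule null_homotopic_idealE)
    have "mor1 f \<cdot> s \<cdot> map0 (tgt n) \<^bold>+ map1 (src f) \<cdot> (mor2 f \<cdot> t) = mor1 f \<cdot> mor1 n"
      using n 4(1,3) Comp_assoc'[of "map1 (src f)" "mor2 f" t] by (simp add: diagram_simps flip: n_eq)
    moreover have "f \<cdot>\<^bsub>diagram_category C\<^esub> n \<in> Arr (diagram_category C)"
      using n 4 by (intro D.Comp_type)
    ultimately show ?case
      using n 4(1,3) by (intro null_homotopic_idealI[where s = "mor1 f \<cdot> s" and t = "mor2 f \<cdot> t"])
        (simp_all add: diagram_simps)
  next
    case (5 n f)
    obtain s t where n: "n \<in> Arr (diagram_category C)"
      "s \<in> Arr C" "Dom C s = ob1 (src n)" "Cod C s = ob0 (tgt n)"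
      "t \<in> Arr C" "Dom C t = ob2 (src n)" "Cod C t = ob1 (tgt n)"
      and n_eq: "s \<cdot> map0 (tgt n) \<^bold>+ map1 (src n) \<cdot> t = mor1 n"
      using 5(1) by (rule null_homotopic_idealE)
    have "s \<cdot> mor0 f \<cdot> map0 (tgt f) \<^bold>+ map1 (src n) \<cdot> (t \<cdot> mor1 f) = mor1 n \<cdot> mor1 f"
      using n 5(2,3) by (simp add: diagram_simps flip: n_eq)
    moreover have "n \<cdot>\<^bsub>diagram_category C\<^esub> f \<in> Arr (diagram_category C)"
      using n 5 by (intro D.Comp_type)
    ultimately show ?case
      using n 5(2,3) by (intro null_homotopic_idealI[where s = "s \<cdot> mor0 f" and t = "t \<cdot> mor1 f"])
        (simp_all add: diagram_simps)
  qed
qed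

end

text \<open>Makes the theory of quotients available under the prefix \<open>D\<close>;
  \<open>D.Q\<close> is \<open>adelman_category C\<close> unfolded.\<close>

sublocale additive_category \<subseteq> D: preadditive_ideal "diagram_category C" "null_homotopic_ideal C"
  by (rule preadditive_ideal_null_homotopic)

lemma src_tgt [simp]:
  "src (ker_mor C f) = ker_ob C f" "tgt (ker_mor C f) = src f"
  "src (coker_mor C f) = tgt f" "tgt (coker_mor C f) = coker_ob C f"
  "src (I_mor C f) = coker_ob C (ker_mor C f)" "tgt (I_mor C f) = ker_ob C (coker_mor C f)"
  "src (J_mor C f) = ker_ob C (coker_mor C f)" "tgt (J_mor C f) = coker_ob C (ker_mor C f)"
  by (simp_all add: ker_mor_def coker_mor_def I_mor_def J_mor_def Let_def)

context additive_category
begin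

text \<open>Congruence of parallel morphisms of diagrams becomes a single equation between middle
  components, to be solved by a homotopy \<open>(s, t)\<close>.\<close>

lemma null_homotopic_congI:
  assumes "f \<in> Arr (diagram_category C)" "g \<in> Arr (diagram_category C)" "src f = src g" "tgt f = tgt g"
    and "s \<in> Arr C" "Dom C s = ob1 (src g)" "Cod C s = ob0 (tgt g)"
    and "t \<in> Arr C" "Dom C t = ob2 (src g)" "Cod C t = ob1 (tgt g)"
    and "s \<cdot> map0 (tgt g) \<^bold>+ map1 (src g) \<cdot> t = mor1 f \<^bold>+ neg C (mor1 g)"
  shows "D.cong f g"
proof -
  have "f \<^bold>+\<^bsub>diagram_category C\<^esub> neg (diagram_category C) g \<in> Arr (diagram_category C)"
    using assms by (intro D.Add_type) (simp_all, simp_all add: diagram_category_def)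
  then have "f \<^bold>+\<^bsub>diagram_category C\<^esub> neg (diagram_category C) g \<in> null_homotopic_ideal C"
    using assms by (intro null_homotopic_idealI[where s = s and t = t])
      (simp_all add: diagram_mor_neg, simp_all add: diagram_category_def)
  then show ?thesis
    using assms by (simp add: D.cong_def) (simp add: diagram_category_def)
qed

end

section \<open>Matrix computations for a morphism of diagrams given by its components\<close>

lemmas ker_coker_defs = ker_mor_def ker_ob_def coker_mor_def coker_ob_def Let_def

text \<open>Names all components and makes their types and the two squares rewrite rules, so that
  the block matrix identities below are settled by simplification.\<close>

locale diagram_morphism = additive_category C
  for C :: "('o, 'm, 'z) additive_category_scheme" (structure) +
  fixes A0 A1 A2 a0 a1 B0 B1 B2 b0 b1 f0 f1 f2
  assumes objects [simp]: "A0 \<in> Ob C" "A1 \<in> Ob C" "A2 \<in> Ob C" "B0 \<in> Ob C" "B1 \<in> Ob C" "B2 \<in> Ob C"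
    and arrows [simp]: "a0 \<in> Arr C" "a1 \<in> Arr C" "b0 \<in> Arr C" "b1 \<in> Arr C"
      "f0 \<in> Arr C" "f1 \<in> Arr C" "f2 \<in> Arr C"
    and Doms [simp]: "Dom C a0 = A0" "Dom C a1 = A1" "Dom C b0 = B0" "Dom C b1 = B1"
      "Dom C f0 = A0" "Dom C f1 = A1" "Dom C f2 = A2"
    and Cods [simp]: "Cod C a0 = A1" "Cod C a1 = A2" "Cod C b0 = B1" "Cod C b1 = B2"
      "Cod C f0 = B0" "Cod C f1 = B1" "Cod C f2 = B2"
    and commute [simp]: "a0 \<cdot> f1 = f0 \<cdot> b0" "a1 \<cdot> f2 = f1 \<cdot> b1"
begin

abbreviation A where "A \<equiv> Diagram A0 A1 A2 a0 a1"
abbreviation B where "B \<equiv> Diagram B0 B1 B2 b0 b1"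
abbreviation f where "f \<equiv> Diagram_Mor A B f0 f1 f2"

lemma f_Arr [simp]: "f \<in> Arr (diagram_category C)"
  by (simp add: diagram_simps)

lemma ker_mor_Arr [simp]: "ker_mor C f \<in> Arr (diagram_category C)"
  by (simp add: diagram_simps ker_coker_defs matrix_simps)

lemma coker_mor_Arr [simp]: "coker_mor C f \<in> Arr (diagram_category C)"
  by (simp add: diagram_simps ker_coker_defs matrix_simps)

lemma I_mor_Arr [simp]: "I_mor C f \<in> Arr (diagram_category C)"
  by (simp add: diagram_simps I_mor_def ker_coker_defs matrix_simps)

lemma J_mor_Arr [simp]: "J_mor C f \<in> Arr (diagram_category C)"
  by (simp add: diagram_simps J_mor_def ker_coker_defs matrix_simps)

lemma coker_ker_Arr [simp]: "coker_mor C (ker_mor C f) \<in> Arr (diagram_category C)"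
  by (simp add: diagram_simps ker_coker_defs matrix_simps)

lemma ker_coker_Arr [simp]: "ker_mor C (coker_mor C f) \<in> Arr (diagram_category C)"
  by (simp add: diagram_simps ker_coker_defs matrix_simps)

text \<open>The outer morphisms consist of rows \<open>(1 0)\<close> and of the corresponding
  columns, so the product picks the upper left entry of each matrix of
  \<open>I_mor C f\<close>.\<close>

lemma factorisation:
  "coker_mor C (ker_mor C f) \<cdot>\<^bsub>diagram_category C\<^esub> I_mor C f \<cdot>\<^bsub>diagram_category C\<^esub> ker_mor C (coker_mor C f) = f"
  by (simp add: diagram_simps I_mor_def ker_coker_defs matrix_simps)

lemma I_J_cong_Idn:
  "D.cong (I_mor C f \<cdot>\<^bsub>diagram_category C\<^esub> J_mor C f) (Idn (diagram_category C) (coker_ob C (ker_mor C f)))"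
proof (rule null_homotopic_congI)
  show "I_mor C f \<cdot>\<^bsub>diagram_category C\<^esub> J_mor C f \<in> Arr (diagram_category C)"
    by (intro D.Comp_type) (simp_all, simp add: diagram_category_def)
  show "Idn (diagram_category C) (coker_ob C (ker_mor C f)) \<in> Arr (diagram_category C)"
    using coker_ker_Arr by (intro D.Idn_type) (simp add: diagram_simps)
  let ?s = "Zero C (A1 \<oplus> (A2 \<oplus> B1)) (A0 \<oplus> (A1 \<oplus> B0))"
  \<comment> \<open>In the middle component the composite minus the identity has the rows
    \<open>a1 \<cdot> ?r\<close>, \<open>?r\<close> and zero. The second map of the diagram is
    diagonal with blocks \<open>a1\<close> and an identity; splitting it off on the left leaves
    \<open>?t\<close>.\<close>
  let ?r = "row C (Zero C A2 A1) (row C (neg C (Idn C A2)) (Zero C A2 B1))"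
  let ?t = "col C ?r (col C ?r (Zero C B1 (A1 \<oplus> (A2 \<oplus> B1))))"
  show "?s \<cdot> map0 (tgt (Idn (diagram_category C) (coker_ob C (ker_mor C f)))) \<^bold>+
      map1 (src (Idn (diagram_category C) (coker_ob C (ker_mor C f)))) \<cdot> ?t =
    mor1 (I_mor C f \<cdot>\<^bsub>diagram_category C\<^esub> J_mor C f) \<^bold>+
      neg C (mor1 (Idn (diagram_category C) (coker_ob C (ker_mor C f))))"
    by (simp add: diagram_category_def I_mor_def J_mor_def ker_coker_defs matrix_simps)
qed (simp_all add: diagram_category_def ker_coker_defs)

lemma J_I_cong_Idn:
  "D.cong (J_mor C f \<cdot>\<^bsub>diagram_category C\<^esub> I_mor C f) (Idn (diagram_category C) (ker_ob C (coker_mor C f)))"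
proof (rule null_homotopic_congI)
  show "J_mor C f \<cdot>\<^bsub>diagram_category C\<^esub> I_mor C f \<in> Arr (diagram_category C)"
    by (intro D.Comp_type) (simp_all, simp add: diagram_category_def)
  show "Idn (diagram_category C) (ker_ob C (coker_mor C f)) \<in> Arr (diagram_category C)"
    using ker_coker_Arr by (intro D.Idn_type) (simp add: diagram_simps)
  \<comment> \<open>Here the only nonzero row of the difference is the one at \<open>B0\<close>,
    namely \<open>(-b0, (-1, 0))\<close>. The first map of the diagram is diagonal with blocks
    \<open>b0\<close> and an identity; splitting it off on the right leaves
    \<open>(-1, (-1, 0))\<close>.\<close>
  let ?n = "neg C (Idn C B0)"
  let ?s = "col C (Zero C B1 (B0 \<oplus> (B0 \<oplus> A1)))
    (col C (row C ?n (row C ?n (Zero C B0 A1))) (Zero C A1 (B0 \<oplus> (B0 \<oplus> A1))))"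
  let ?t = "Zero C (B2 \<oplus> (B1 \<oplus> A2)) (B1 \<oplus> (B0 \<oplus> A1))"
  show "?s \<cdot> map0 (tgt (Idn (diagram_category C) (ker_ob C (coker_mor C f)))) \<^bold>+
      map1 (src (Idn (diagram_category C) (ker_ob C (coker_mor C f)))) \<cdot> ?t =
    mor1 (J_mor C f \<cdot>\<^bsub>diagram_category C\<^esub> I_mor C f) \<^bold>+
      neg C (mor1 (Idn (diagram_category C) (ker_ob C (coker_mor C f))))"
    by (simp add: diagram_category_def I_mor_def J_mor_def ker_coker_defs matrix_simps)
qed (simp_all add: diagram_category_def ker_coker_defs)

end

context additive_category
begin

text \<open>Reduces an arbitrary arrow to the component form of \<open>diagram_morphism\<close>;
  applied to test morphisms as well as to the given one.\<close>

lemma diagram_morphism_cases: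
  assumes "f \<in> Arr (diagram_category C)"
  obtains A0 A1 A2 a0 a1 B0 B1 B2 b0 b1 f0 f1 f2
  where "f = Diagram_Mor (Diagram A0 A1 A2 a0 a1) (Diagram B0 B1 B2 b0 b1) f0 f1 f2"
    and "diagram_morphism C A0 A1 A2 a0 a1 B0 B1 B2 b0 b1 f0 f1 f2"
proof (cases f)
  case (Diagram_Mor A B f0 f1 f2)
  obtain A0 A1 A2 a0 a1 where A: "A = Diagram A0 A1 A2 a0 a1" by (cases A)
  obtain B0 B1 B2 b0 b1 where B: "B = Diagram B0 B1 B2 b0 b1" by (cases B)
  have "diagram_morphism C A0 A1 A2 a0 a1 B0 B1 B2 b0 b1 f0 f1 f2"
    by unfold_locales (use assms in \<open>auto simp: diagram_simps Diagram_Mor A B\<close>)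
  with Diagram_Mor A B that show thesis by simp
qed

end

section \<open>Universal properties of \<open>ker_mor\<close> and \<open>coker_mor\<close> modulo
  homotopy\<close>

context diagram_morphism
begin

lemma ker_mor_Comp_null: "ker_mor C f \<cdot>\<^bsub>diagram_category C\<^esub> f \<in> null_homotopic_ideal C"
proof (rule null_homotopic_idealI)
  show "ker_mor C f \<cdot>\<^bsub>diagram_category C\<^esub> f \<in> Arr (diagram_category C)"
    by (intro D.Comp_type) (simp_all, simp add: diagram_category_def)
  \<comment> \<open>The projections onto \<open>B0\<close> and \<open>B1\<close>. The entry
    \<open>neg C b0\<close> of the kernel object cancels the contribution of \<open>?s\<close>,
    which leaves the column with entries \<open>f1\<close> and zero.\<close>
  let ?s = "col C (Zero C A1 B0) (Idn C B0)" and ?t = "col C (Zero C A2 B1) (Idn C B1)"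
  show "?s \<cdot> map0 (tgt (ker_mor C f \<cdot>\<^bsub>diagram_category C\<^esub> f)) \<^bold>+
      map1 (src (ker_mor C f \<cdot>\<^bsub>diagram_category C\<^esub> f)) \<cdot> ?t = mor1 (ker_mor C f \<cdot>\<^bsub>diagram_category C\<^esub> f)"
    by (simp add: diagram_category_def ker_coker_defs matrix_simps)
qed (simp_all add: diagram_category_def ker_coker_defs)

lemma coker_mor_Comp_null: "f \<cdot>\<^bsub>diagram_category C\<^esub> coker_mor C f \<in> null_homotopic_ideal C"
proof (rule null_homotopic_idealI)
  show "f \<cdot>\<^bsub>diagram_category C\<^esub> coker_mor C f \<in> Arr (diagram_category C)"
    by (intro D.Comp_type) (simp_all, simp add: diagram_category_def)
  \<comment> \<open>Dually the injections of \<open>A1\<close> and \<open>A2\<close>; now the entry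
    \<open>neg C a1\<close> of the cokernel object is cancelled.\<close>
  let ?s = "row C (Zero C A1 B0) (Idn C A1)" and ?t = "row C (Zero C A2 B1) (Idn C A2)"
  show "?s \<cdot> map0 (tgt (f \<cdot>\<^bsub>diagram_category C\<^esub> coker_mor C f)) \<^bold>+
      map1 (src (f \<cdot>\<^bsub>diagram_category C\<^esub> coker_mor C f)) \<cdot> ?t = mor1 (f \<cdot>\<^bsub>diagram_category C\<^esub> coker_mor C f)"
    by (simp add: diagram_category_def ker_coker_defs matrix_simps)
qed (simp_all add: diagram_category_def ker_coker_defs)

lemma ker_mor_lift:
  assumes t: "t \<in> Arr (diagram_category C)" "tgt t = A"
    and null: "t \<cdot>\<^bsub>diagram_category C\<^esub> f \<in> null_homotopic_ideal C"
  shows "\<exists>u\<in>Hom (diagram_category C) (src t) (ker_ob C f). u \<cdot>\<^bsub>diagram_category C\<^esub> ker_mor C f = t"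
proof -
  obtain T0 T1 T2 d0 d1 t0 t1 t2 where t_eq: "t = Diagram_Mor (Diagram T0 T1 T2 d0 d1) A t0 t1 t2"
    and "diagram_morphism C T0 T1 T2 d0 d1 A0 A1 A2 a0 a1 t0 t1 t2"
    using t by (elim diagram_morphism_cases) auto
  then interpret t: diagram_morphism C T0 T1 T2 d0 d1 A0 A1 A2 a0 a1 t0 t1 t2
    by simp
  obtain s r where [simp]: "s \<in> Arr C" "Dom C s = T1" "Cod C s = B0"
      "r \<in> Arr C" "Dom C r = T2" "Cod C r = B1"
    and homotopy: "s \<cdot> b0 \<^bold>+ d1 \<cdot> r = t1 \<cdot> f1"
    using null by (elim null_homotopic_idealE) (auto simp: diagram_category_def t_eq)
  \<comment> \<open>This is the \<open>B1\<close> entry of the second square of the lift. The first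
    square dictates the entry \<open>d0 \<cdot> s\<close> below, since the first map of the kernel
    object is the identity on \<open>B0\<close>.\<close>
  have "t1 \<cdot> f1 \<^bold>+ neg C (s \<cdot> b0) = d1 \<cdot> r"
    by (simp add: Add_assoc Add_commute[of "d1 \<cdot> r"] flip: homotopy)
  then show ?thesis
    by (intro bexI[of _ "Diagram_Mor (src t) (ker_ob C f) (row C t0 (d0 \<cdot> s)) (row C t1 s) (row C t2 r)"])
      (simp_all add: t_eq diagram_simps ker_coker_defs matrix_simps)
qed

lemma coker_mor_extend:
  assumes t: "t \<in> Arr (diagram_category C)" "src t = B"
    and null: "f \<cdot>\<^bsub>diagram_category C\<^esub> t \<in> null_homotopic_ideal C"
  shows "\<exists>u\<in>Hom (diagram_category C) (coker_ob C f) (tgt t). coker_mor C f \<cdot>\<^bsub>diagram_category C\<^esub> u = t"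
proof -
  obtain T0 T1 T2 d0 d1 t0 t1 t2 where t_eq: "t = Diagram_Mor B (Diagram T0 T1 T2 d0 d1) t0 t1 t2"
    and "diagram_morphism C B0 B1 B2 b0 b1 T0 T1 T2 d0 d1 t0 t1 t2"
    using t by (elim diagram_morphism_cases) auto
  then interpret t: diagram_morphism C B0 B1 B2 b0 b1 T0 T1 T2 d0 d1 t0 t1 t2
    by simp
  obtain s r where [simp]: "s \<in> Arr C" "Dom C s = A1" "Cod C s = T0"
      "r \<in> Arr C" "Dom C r = A2" "Cod C r = T1"
    and homotopy: "s \<cdot> d0 \<^bold>+ a1 \<cdot> r = f1 \<cdot> t1"
    using null by (elim null_homotopic_idealE) (auto simp: diagram_category_def t_eq)
  \<comment> \<open>This is the \<open>A1\<close> entry of the first square of the extension; the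
    second square dictates the entry \<open>r \<cdot> d1\<close> below.\<close>
  have "f1 \<cdot> t1 \<^bold>+ neg C (a1 \<cdot> r) = s \<cdot> d0"
    by (simp add: Add_assoc flip: homotopy)
  then show ?thesis
    by (intro bexI[of _ "Diagram_Mor (coker_ob C f) (tgt t) (col C t0 s) (col C t1 r) (col C t2 (r \<cdot> d1))"])
      (simp_all add: t_eq diagram_simps ker_coker_defs matrix_simps)
qed

lemma ker_mor_mono:
  assumes u: "u \<in> Arr (diagram_category C)" "tgt u = ker_ob C f"
    and null: "u \<cdot>\<^bsub>diagram_category C\<^esub> ker_mor C f \<in> null_homotopic_ideal C"
  shows "u \<in> null_homotopic_ideal C"
proof -
  have mor1_u: "mor1 u \<in> Arr C" "Cod C (mor1 u) = A1 \<oplus> B0" and [simp]: "Dom C (mor1 u) = ob1 (src u)"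
    using u by (auto simp: diagram_simps ker_coker_defs)
  obtain p q where pq: "p \<in> Arr C" "q \<in> Arr C" "Dom C p = Dom C (mor1 u)" "Dom C q = Dom C (mor1 u)"
      "Cod C p = A1" "Cod C q = B0" and u1: "mor1 u = row C p q"
    by (rule row_cases[OF mor1_u objects(2,4)])
  note [simp] = pq[simplified]
  have [simp]: "map1 (src u) \<in> Arr C" "Dom C (map1 (src u)) = ob1 (src u)"
    "Cod C (map1 (src u)) = ob2 (src u)" "ob1 (src u) \<in> Ob C" "ob2 (src u) \<in> Ob C"
    using u by (auto simp: diagram_simps)
  obtain s r where [simp]: "s \<in> Arr C" "Dom C s = ob1 (src u)" "Cod C s = A0"
      "r \<in> Arr C" "Dom C r = ob2 (src u)" "Cod C r = A1"
    and homotopy: "s \<cdot> a0 \<^bold>+ map1 (src u) \<cdot> r = p"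
    using null by (elim null_homotopic_idealE) (auto simp: diagram_category_def ker_coker_defs u1)
  \<comment> \<open>The given homotopy accounts for \<open>p\<close>. The first map of the kernel
    object is the identity on \<open>B0\<close>, so \<open>q\<close> can be absorbed into
    \<open>s\<close> unchanged.\<close>
  show ?thesis
    by (rule null_homotopic_idealI[where s = "row C s q" and t = "row C r (Zero C (ob2 (src u)) B0)"])
      (use u homotopy in \<open>simp_all add: u1 ker_coker_defs matrix_simps\<close>)
qed

lemma coker_mor_epi:
  assumes u: "u \<in> Arr (diagram_category C)" "src u = coker_ob C f"
    and null: "coker_mor C f \<cdot>\<^bsub>diagram_category C\<^esub> u \<in> null_homotopic_ideal C"
  shows "u \<in> null_homotopic_ideal C"
proof -
  have mor1_u: "mor1 u \<in> Arr C" "Dom C (mor1 u) = B1 \<oplus> A2" and [simp]: "Cod C (mor1 u) = ob1 (tgt u)"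
    using u by (auto simp: diagram_simps ker_coker_defs)
  obtain p q where pq: "p \<in> Arr C" "q \<in> Arr C" "Cod C p = Cod C (mor1 u)" "Cod C q = Cod C (mor1 u)"
      "Dom C p = B1" "Dom C q = A2" and u1: "mor1 u = col C p q"
    by (rule col_cases[OF mor1_u objects(5,3)])
  note [simp] = pq[simplified]
  have [simp]: "map0 (tgt u) \<in> Arr C" "Dom C (map0 (tgt u)) = ob0 (tgt u)"
    "Cod C (map0 (tgt u)) = ob1 (tgt u)" "ob0 (tgt u) \<in> Ob C" "ob1 (tgt u) \<in> Ob C"
    using u by (auto simp: diagram_simps)
  obtain s r where [simp]: "s \<in> Arr C" "Dom C s = B1" "Cod C s = ob0 (tgt u)"
      "r \<in> Arr C" "Dom C r = B2" "Cod C r = ob1 (tgt u)"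
    and homotopy: "s \<cdot> map0 (tgt u) \<^bold>+ b1 \<cdot> r = p"
    using null by (elim null_homotopic_idealE) (auto simp: diagram_category_def ker_coker_defs u1)
  \<comment> \<open>Dually \<open>q\<close> is absorbed into \<open>t\<close>, since the second map
    of the cokernel object is the identity on \<open>A2\<close>.\<close>
  show ?thesis
    by (rule null_homotopic_idealI[where s = "col C s (Zero C A2 (ob0 (tgt u)))" and t = "col C r q"])
      (use u homotopy in \<open>simp_all add: u1 ker_coker_defs matrix_simps\<close>)
qed

end

section \<open>Kernels, cokernels and the induced morphism in the Adelman category\<close>

context additive_category
begin

lemma Dom_Cod_diagram: "Dom (diagram_category C) = src" "Cod (diagram_category C) = tgt"
  by (simp_all add: diagram_category_def)

lemma src_tgt_Comp [simp]:
  "src (f \<cdot>\<^bsub>diagram_category C\<^esub> g) = src f" "tgt (f \<cdot>\<^bsub>diagram_category C\<^esub> g) = tgt g"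
  by (simp_all add: diagram_category_def)

text \<open>The first claim is what permits a further cokernel or kernel to be formed from the
  result.\<close>

lemma ker_mor_is_kernel:
  assumes "f \<in> Arr (diagram_category C)"
  shows "ker_mor C f \<in> Arr (diagram_category C)"
    and "is_kernel (adelman_category C) (adelman_class C f) (adelman_class C (ker_mor C f))"
proof -
  obtain A0 A1 A2 a0 a1 B0 B1 B2 b0 b1 f0 f1 f2
    where f: "f = Diagram_Mor (Diagram A0 A1 A2 a0 a1) (Diagram B0 B1 B2 b0 b1) f0 f1 f2"
      and "diagram_morphism C A0 A1 A2 a0 a1 B0 B1 B2 b0 b1 f0 f1 f2"
    using assms by (rule diagram_morphism_cases)
  then interpret diagram_morphism C A0 A1 A2 a0 a1 B0 B1 B2 b0 b1 f0 f1 f2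
    by simp
  show "ker_mor C f \<in> Arr (diagram_category C)"
    unfolding f by (rule ker_mor_Arr)
  show "is_kernel (adelman_category C) (adelman_class C f) (adelman_class C (ker_mor C f))"
    unfolding f adelman_category_def adelman_class_def
    by (rule D.is_kernel_residue_classI, unfold Dom_Cod_diagram src_tgt diagram_mor.sel)
      (simp_all only: f_Arr ker_mor_Arr ker_mor_Comp_null ker_mor_lift ker_mor_mono)
qed

lemma coker_mor_is_cokernel:
  assumes "f \<in> Arr (diagram_category C)"
  shows "coker_mor C f \<in> Arr (diagram_category C)"
    and "is_cokernel (adelman_category C) (adelman_class C f) (adelman_class C (coker_mor C f))"
proof -
  obtain A0 A1 A2 a0 a1 B0 B1 B2 b0 b1 f0 f1 f2
    where f: "f = Diagram_Mor (Diagram A0 A1 A2 a0 a1) (Diagram B0 B1 B2 b0 b1) f0 f1 f2"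
      and "diagram_morphism C A0 A1 A2 a0 a1 B0 B1 B2 b0 b1 f0 f1 f2"
    using assms by (rule diagram_morphism_cases)
  then interpret diagram_morphism C A0 A1 A2 a0 a1 B0 B1 B2 b0 b1 f0 f1 f2
    by simp
  show "coker_mor C f \<in> Arr (diagram_category C)"
    unfolding f by (rule coker_mor_Arr)
  show "is_cokernel (adelman_category C) (adelman_class C f) (adelman_class C (coker_mor C f))"
    unfolding f adelman_category_def adelman_class_def
    by (rule D.is_cokernel_residue_classI, unfold Dom_Cod_diagram src_tgt diagram_mor.sel)
      (simp_all only: f_Arr coker_mor_Arr coker_mor_Comp_null coker_mor_extend coker_mor_epi)
qed

end

theorem theorem34:
  fixes C :: "('o, 'm, 'z) additive_category_scheme"
    and A B :: "('o, 'm) diagram" and f :: "('o, 'm) diagram_mor"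
  assumes "additive_category C"
    and "f \<in> Hom (diagram_category C) A B"
  shows "I_mor C f \<in> Hom (diagram_category C) (coker_ob C (ker_mor C f)) (ker_ob C (coker_mor C f)) \<and>
    J_mor C f \<in> Hom (diagram_category C) (ker_ob C (coker_mor C f)) (coker_ob C (ker_mor C f)) \<and>
    adelman_class C (I_mor C f)
           \<in> Hom (adelman_category C) (coker_ob C (ker_mor C f)) (ker_ob C (coker_mor C f)) \<and>
    adelman_class C (J_mor C f)
           \<in> Hom (adelman_category C) (ker_ob C (coker_mor C f)) (coker_ob C (ker_mor C f)) \<and>
    is_isomorphism (adelman_category C) (adelman_class C (I_mor C f)) \<and>
    is_inverse (adelman_category C) (adelman_class C (I_mor C f)) (adelman_class C (J_mor C f)) \<and>
    adelman_class C (coker_mor C (ker_mor C f)) \<cdot>\<^bsub>adelman_category C\<^esub> adelman_class C (I_mor C f)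
           \<cdot>\<^bsub>adelman_category C\<^esub> adelman_class C (ker_mor C (coker_mor C f)) = adelman_class C f \<and>
    kernel_cokernel_factorisation (adelman_category C) (adelman_class C f)
           (adelman_class C (ker_mor C f)) (adelman_class C (coker_mor C f))
           (adelman_class C (coker_mor C (ker_mor C f))) (adelman_class C (ker_mor C (coker_mor C f))) \<and>
    is_induced_morphism (adelman_category C) (adelman_class C f)
           (adelman_class C (coker_mor C (ker_mor C f))) (adelman_class C (ker_mor C (coker_mor C f)))
           (adelman_class C (I_mor C f))"
proof -
  interpret additive_category C by fact
  have f_Arr: "f \<in> Arr (diagram_category C)"
    using assms(2) by (simp add: in_Hom_iff)
  obtain A0 A1 A2 a0 a1 B0 B1 B2 b0 b1 f0 f1 f2
    where f: "f = Diagram_Mor (Diagram A0 A1 A2 a0 a1) (Diagram B0 B1 B2 b0 b1) f0 f1 f2"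
      and "diagram_morphism C A0 A1 A2 a0 a1 B0 B1 B2 b0 b1 f0 f1 f2"
    using f_Arr by (rule diagram_morphism_cases)
  then interpret M: diagram_morphism C A0 A1 A2 a0 a1 B0 B1 B2 b0 b1 f0 f1 f2
    by simp
  note kernel = ker_mor_is_kernel[OF f_Arr] and cokernel = coker_mor_is_cokernel[OF f_Arr]
  \<comment> \<open>The same two lemmas, applied to the kernel and to the cokernel of
    \<open>f\<close>, yield the remaining half of the factorisation data.\<close>
  note coimage = coker_mor_is_cokernel[OF kernel(1)] and image = ker_mor_is_kernel[OF cokernel(1)]
  note [simp] = f_Arr kernel(1) cokernel(1) coimage(1) image(1)
  note adelman = adelman_category_def adelman_class_def
  have Adel: "preadditive_category (adelman_category C)"
    unfolding adelman_category_def by (rule D.preadditive_category_Q)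
  have I [simp]: "I_mor C f \<in> Arr (diagram_category C)" and J [simp]: "J_mor C f \<in> Arr (diagram_category C)"
    unfolding f by (rule M.I_mor_Arr M.J_mor_Arr)+
  have Idn_Arr: "Idn (diagram_category C) (src g) \<in> Arr (diagram_category C)"
    "Idn (diagram_category C) (tgt g) \<in> Arr (diagram_category C)" if "g \<in> Arr (diagram_category C)" for g
    using D.Dom_Ob[OF that] D.Cod_Ob[OF that] by (simp_all add: Dom_Cod_diagram)
  have I_Hom: "adelman_class C (I_mor C f)
      \<in> Hom (adelman_category C) (coker_ob C (ker_mor C f)) (ker_ob C (coker_mor C f))"
    and J_Hom: "adelman_class C (J_mor C f)
      \<in> Hom (adelman_category C) (ker_ob C (coker_mor C f)) (coker_ob C (ker_mor C f))"
    unfolding adelman by (simp_all add: in_Hom_iff Dom_Cod_diagram)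
  have "D.cls (I_mor C f \<cdot>\<^bsub>diagram_category C\<^esub> J_mor C f)
      = D.cls (Idn (diagram_category C) (coker_ob C (ker_mor C f)))"
    "D.cls (J_mor C f \<cdot>\<^bsub>diagram_category C\<^esub> I_mor C f)
      = D.cls (Idn (diagram_category C) (ker_ob C (coker_mor C f)))"
    \<comment> \<open>The source and target of \<open>I_mor C f\<close> are the two objects whose
      identities occur, hence \<open>Idn_Arr[OF I]\<close>.\<close>
    using M.I_J_cong_Idn M.J_I_cong_Idn Idn_Arr[OF I] unfolding f[symmetric]
    by (simp_all add: D.residue_class_eq_iff Dom_Cod_diagram)
  then have inverse: "is_inverse (adelman_category C) (adelman_class C (I_mor C f)) (adelman_class C (J_mor C f))"
    using J_Hom unfolding is_inverse_def adelman by (simp add: Dom_Cod_diagram)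
  have factors: "adelman_class C (coker_mor C (ker_mor C f)) \<cdot>\<^bsub>adelman_category C\<^esub> adelman_class C (I_mor C f)
      \<cdot>\<^bsub>adelman_category C\<^esub> adelman_class C (ker_mor C (coker_mor C f)) = adelman_class C f"
    \<comment> \<open>The equation of representatives and the composite of classes are both
      bracketed to the left, so reassociation in the diagram category is switched off.\<close>
    using M.factorisation unfolding f[symmetric] adelman
    by (simp add: Dom_Cod_diagram del: D.Comp_assoc')
  have fac: "kernel_cokernel_factorisation (adelman_category C) (adelman_class C f)
      (adelman_class C (ker_mor C f)) (adelman_class C (coker_mor C f))
      (adelman_class C (coker_mor C (ker_mor C f))) (adelman_class C (ker_mor C (coker_mor C f)))"
    using kernel cokernel coimage image by (simp add: kernel_cokernel_factorisation_def)
  have "is_induced_morphism (adelman_category C) (adelman_class C f)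
      (adelman_class C (coker_mor C (ker_mor C f))) (adelman_class C (ker_mor C (coker_mor C f)))
      (adelman_class C (I_mor C f))"
    using Adel fac _ factors
  proof (rule preadditive_category.is_induced_morphismI)
    show "adelman_class C (I_mor C f)
      \<in> Hom (adelman_category C) (Cod (adelman_category C) (adelman_class C (coker_mor C (ker_mor C f))))
          (Dom (adelman_category C) (adelman_class C (ker_mor C (coker_mor C f))))"
      using I_Hom unfolding adelman by (simp add: Dom_Cod_diagram)
  qed
  then show ?thesis
    using I_Hom J_Hom inverse factors fac
    by (auto simp: is_isomorphism_def in_Hom_iff Dom_Cod_diagram)
qed

end
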